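(* Let $1 \le q < k$ be integers and let $\gamma, D > 0$. For every $\varepsilon > 0$ there is a constant $c = c(\varepsilon,k,\gamma,D) > 0$ such that the following holds. Assume that $\mathcal{H}$ is a $k$-uniform hypergraph with $v(\mathcal{H}) \le N$ vertices, $e(\mathcal{H}) \ge \gamma N^q$ edges, and $\Delta_q(\mathcal{H}) \le D$. For $p \in (0,1]$ let $X = e(\mathcal{H}_p)$ and $\mu = \mathbb{E} X$. Then for all $p \in (0,1]$ we have $$\mathbb{P}(X \ge (1+\varepsilon)\mu) \le \exp\Bigl(-c \min\bigl\{\mu, \; \mu^{1/q}\log(e/p)\bigr\}\Bigr).$$
   Context: Hypergraphs are finite (with a set of edges, each edge being a subset of the vertex set); $v(\mathcal{H})$ and $e(\mathcal{H})$ denote the number of vertices and edges of $\mathcal{H}$, and $\mathcal{H}$ is $k$-uniform if every edge has exactly $k$ vertices. $\Delta_q(\mathcal{H})$ denotes the maximum number of edges of $\mathcal{H}$ that contain $q$ given vertices, i.e. $\Delta_q(\mathcal{H}) = \max_{U \subseteq V(\mathcal{H}), |U|=q} |\{f \in \mathcal{H} : U \subseteq f\}|$. $V_p(\mathcal{H})$ is the binomial random subset of $V(\mathcal{H})$ in which each vertex is included independently with probability $p$, and $\mathcal{H}_p = \mathcal{H}[V_p(\mathcal{H})]$ is the induced subhypergraph, whose edges are all $f \in \mathcal{H}$ with $f \subseteq V_p(\mathcal{H})$. In $\log(e/p)$, $e$ is Euler's number. *)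

theory Defs
  imports "HOL-Probability.Probability"
begin

record 'a hypergraph =
  verts :: "'a set"
  edges :: "'a set set"

definition finite_hypergraph :: "'a hypergraph \<Rightarrow> bool" where
  "finite_hypergraph H \<longleftrightarrow> finite (verts H) \<and> (\<forall>f\<in>edges H. f \<subseteq> verts H)"

definition uniform :: "nat \<Rightarrow> 'a hypergraph \<Rightarrow> bool" where
  "uniform k H \<longleftrightarrow> (\<forall>f\<in>edges H. card f = k)"

definition num_verts :: "'a hypergraph \<Rightarrow> nat" where
  "num_verts H = card (verts H)"

definition num_edges :: "'a hypergraph \<Rightarrow> nat" where
  "num_edges H = card (edges H)"

text \<open>Inserting 0 only matters when there are fewer than \<open>q\<close> vertices: the maximum over
  the empty family is then 0.\<close>

definition max_degree :: "nat \<Rightarrow> 'a hypergraph \<Rightarrow> nat" where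
  "max_degree q H =
     Max (insert 0 ((\<lambda>U. card {f \<in> edges H. U \<subseteq> f}) ` {U. U \<subseteq> verts H \<and> card U = q}))"

definition induced :: "'a hypergraph \<Rightarrow> 'a set \<Rightarrow> 'a hypergraph" where
  "induced H W = \<lparr>verts = verts H \<inter> W, edges = {f \<in> edges H. f \<subseteq> W}\<rparr>"

text \<open>Intended for finite \<open>V\<close> and \<open>p \<in> [0, 1]\<close>: the members of the random subset are the
  successes of independent Bernoulli trials, one for each element of \<open>V\<close>.\<close>

definition binomial_subset :: "'a set \<Rightarrow> real \<Rightarrow> 'a set pmf" where
  "binomial_subset V p =
     map_pmf (\<lambda>b. {v \<in> V. b v}) (Pi_pmf V False (\<lambda>_. bernoulli_pmf p))"

end

theory Submission
  imports Defs "HOL-Real_Asymp.Real_Asymp"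
begin

text \<open>
  Write \<open>L = ln (e / p)\<close> and \<open>x = N * p powr (k / q)\<close>, so that \<open>\<mu>\<close> and \<open>x ^ q\<close> agree up to
  constants. Everything rests on a restricted moment bound: count the sequences of \<open>t\<close> items
  (edges, or pairs of edges) inside the random set in which every item is admissible for the set
  of vertices occupied before it, and apply Markov's inequality.

  An edge that meets a set of \<open>O(x L)\<close> occupied vertices without lying inside it contributes a
  factor \<open>p powr (1 / k)\<close>, which beats every power of \<open>L\<close> when \<open>p\<close> is small. Hence sequences
  of \<open>m = \<Theta>(min \<mu> (x L))\<close> edges, each with a new vertex, have essentially the mean \<open>\<mu> ^ m\<close>, and
  apart from an event of probability \<open>exp (- \<Omega>(m))\<close> a large value of \<open>X\<close> forces a seed:
  \<open>O(m)\<close> vertices of the random set that span \<open>\<Omega>(\<mu>)\<close> edges. By the Cauchy-Schwarz inequality a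
  seed contains \<open>\<Omega>(\<mu>\<^sup>2 / m)\<close> pairs of intersecting edges not inside a given set of few vertices,
  whereas the expected number of such pairs is smaller by a power of \<open>p\<close>. So
  sequences of \<open>\<Theta>(x)\<close> pairs show that a seed has probability at most
  \<open>p powr \<Omega>(x) = exp (- \<Omega>(x L))\<close>. If \<open>p\<close> is bounded below, \<open>\<Theta>(x)\<close> arbitrary edges suffice, and
  if \<open>min \<mu> (x L)\<close> is bounded, Markov's inequality for \<open>X\<close> itself does.
\<close>

section \<open>Restricted moments of a binomial random subset\<close>

lemma set_binomial_subset: "finite V \<Longrightarrow> set_pmf (binomial_subset V p) \<subseteq> Pow V"
  by (auto simp: binomial_subset_def)

lemma integrable_binomial_subset:
  fixes f :: "'a set \<Rightarrow> real"
  assumes "finite V"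
  shows "integrable (binomial_subset V p) f"
  using finite_subset[OF set_binomial_subset[OF assms]] assms
  by (intro integrable_measure_pmf_finite) auto

lemma prob_superset_binomial_subset:
  assumes "finite V" "U \<subseteq> V" "0 \<le> p" "p \<le> 1"
  shows "measure_pmf.prob (binomial_subset V p) {W. U \<subseteq> W} = p ^ card U"
proof -
  \<comment> \<open>As a product event over all of \<open>V\<close>, coordinates outside
    \<open>U\<close> are unconstrained and contribute probability 1.\<close>
  have vim: "(\<lambda>b. {v \<in> V. b v}) -` {W. U \<subseteq> W} = Pi V (\<lambda>v. if v \<in> U then {True} else UNIV)"
    using assms(2) by (auto simp: Pi_def split: if_splits)
  have "measure_pmf.prob (binomial_subset V p) {W. U \<subseteq> W} =
     (\<Prod>v\<in>V. measure_pmf.prob (bernoulli_pmf p) (if v \<in> U then {True} else UNIV))"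
    unfolding binomial_subset_def measure_map_pmf vim
    by (rule measure_Pi_pmf_Pi[OF assms(1)])
  also have "\<dots> = (\<Prod>v\<in>V. if v \<in> U then p else 1)"
    using assms by (intro prod.cong) (auto simp: measure_pmf_single)
  also have "\<dots> = p ^ card U"
    using assms by (simp add: prod.If_cases Int_absorb1)
  finally show ?thesis .
qed

text \<open>\<open>chain_count R vs n U W\<close> counts the sequences of \<open>n\<close> items lying in \<open>W\<close> in which each
  item is admissible for the set of vertices occupied so far, starting from \<open>U\<close>.\<close>

primrec chain_count :: "('a set \<Rightarrow> 'b set) \<Rightarrow> ('b \<Rightarrow> 'a set) \<Rightarrow> nat \<Rightarrow> 'a set \<Rightarrow> 'a set \<Rightarrow> real" where
  "chain_count R vs 0 U W = 1"
| "chain_count R vs (Suc n) U W = (\<Sum>e\<in>{e \<in> R U. vs e \<subseteq> W}. chain_count R vs n (U \<union> vs e) W)"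

lemma chain_count_nonneg: "chain_count R vs n U W \<ge> 0"
  by (induction n arbitrary: U) (auto intro: sum_nonneg)

text \<open>The invariant of both inductions on chains: after an item with at most \<open>a\<close>
  vertices, the vertex budget \<open>l\<close> still has room for \<open>n\<close> more.\<close>

lemma card_Un_le_step:
  assumes "card U + a * Suc n \<le> l" "card B \<le> a"
  shows "card (U \<union> B) + a * n \<le> (l::nat)"
  using card_Un_le[of U B] assms by simp

text \<open>Expose the first item \<open>e\<close>. By induction the rest contributes at most
  \<open>\<Lambda> ^ n * p ^ card (U \<union> vs e)\<close>, and the extra factors
  \<open>p ^ card (vs e - U)\<close> sum to at most \<Lambda> over \<open>R U\<close>. The budget
  \<open>l\<close> ensures that \<open>wt\<close> applies to every occupied set that is
  reached.\<close>

lemma expectation_chain_count_le: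
  fixes p \<Lambda> :: real
  assumes V: "finite V" and p: "0 \<le> p" "p \<le> 1"
    and vs: "\<And>U e. e \<in> R U \<Longrightarrow> vs e \<subseteq> V \<and> card (vs e) \<le> a"
    and fin: "\<And>U. finite (R U)"
    and wt: "\<And>U. U \<subseteq> V \<Longrightarrow> card U \<le> l \<Longrightarrow> (\<Sum>e\<in>R U. p ^ card (vs e - U)) \<le> \<Lambda>"
    and \<Lambda>: "\<Lambda> \<ge> 0"
  shows "U \<subseteq> V \<Longrightarrow> card U + a * n \<le> l \<Longrightarrow>
    measure_pmf.expectation (binomial_subset V p)
      (\<lambda>W. if U \<subseteq> W then chain_count R vs n U W else 0) \<le> \<Lambda> ^ n * p ^ card U"
proof (induction n arbitrary: U)
  case 0
  have "measure_pmf.expectation (binomial_subset V p) (\<lambda>W. if U \<subseteq> W then 1 else (0::real)) =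
      measure_pmf.expectation (binomial_subset V p) (indicat_real {W. U \<subseteq> W})"
    by (intro Bochner_Integration.integral_cong) (auto simp: indicator_def)
  then show ?case
    using prob_superset_binomial_subset[OF V 0(1) p] by (simp cong: if_cong)
next
  case (Suc n)
  let ?P = "binomial_subset V p"
  let ?g = "\<lambda>U W. if U \<subseteq> W then chain_count R vs n U W else 0"
  have finU: "finite U" using Suc.prems(1) V by (rule finite_subset)
  have finv: "finite (vs e)" if "e \<in> R U" for e
    using vs[OF that] V by (auto intro: finite_subset)
  have "measure_pmf.expectation ?P (\<lambda>W. if U \<subseteq> W then chain_count R vs (Suc n) U W else 0) =
     measure_pmf.expectation ?P (\<lambda>W. \<Sum>e\<in>R U. ?g (U \<union> vs e) W)"
  proof (intro Bochner_Integration.integral_cong refl)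
    fix W
    show "(if U \<subseteq> W then chain_count R vs (Suc n) U W else 0) = (\<Sum>e\<in>R U. ?g (U \<union> vs e) W)"
      using fin[of U] by (auto simp: sum.If_cases Int_def intro!: sum.neutral)
  qed
  also have "\<dots> = (\<Sum>e\<in>R U. measure_pmf.expectation ?P (?g (U \<union> vs e)))"
    by (intro Bochner_Integration.integral_sum integrable_binomial_subset V)
  also have "\<dots> \<le> (\<Sum>e\<in>R U. \<Lambda> ^ n * p ^ card (U \<union> vs e))"
    using vs Suc.prems by (intro sum_mono Suc.IH card_Un_le_step) auto
  also have "\<dots> = (\<Sum>e\<in>R U. \<Lambda> ^ n * p ^ card U * p ^ card (vs e - U))"
  proof (intro sum.cong refl)
    fix e assume e: "e \<in> R U"
    have "card (U \<union> vs e) = card U + card (vs e - U)"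
      using finU finv[OF e] card_Un_disjoint[of U "vs e - U"] by auto
    then show "\<Lambda> ^ n * p ^ card (U \<union> vs e) = \<Lambda> ^ n * p ^ card U * p ^ card (vs e - U)"
      by (simp add: power_add)
  qed
  also have "\<dots> = \<Lambda> ^ n * p ^ card U * (\<Sum>e\<in>R U. p ^ card (vs e - U))"
    by (simp add: sum_distrib_left)
  also have "\<dots> \<le> \<Lambda> ^ n * p ^ card U * \<Lambda>"
    using Suc.prems p \<Lambda> by (intro mult_left_mono wt) auto
  finally show ?case by (simp add: mult_ac)
qed

text \<open>Build the sequence greedily: within the budget \<open>l\<close>, each occupied set
  leaves at least \<open>lam\<close> choices for the next item.\<close>

lemma chain_count_ge:
  fixes lam :: real
  assumes lb: "\<And>U. U \<subseteq> W \<Longrightarrow> card U \<le> l \<Longrightarrow> lam \<le> card {e \<in> R U. vs e \<subseteq> W}"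
    and a: "\<And>U e. e \<in> R U \<Longrightarrow> card (vs e) \<le> a" and lam: "lam \<ge> 0"
  shows "U \<subseteq> W \<Longrightarrow> card U + a * n \<le> l \<Longrightarrow> lam ^ n \<le> chain_count R vs n U W"
proof (induction n arbitrary: U)
  case 0
  then show ?case by simp
next
  case (Suc n)
  have "lam ^ Suc n \<le> real (card {e \<in> R U. vs e \<subseteq> W}) * lam ^ n"
    using lb[of U] Suc.prems lam by (auto intro!: mult_right_mono)
  also have "\<dots> = (\<Sum>e\<in>{e \<in> R U. vs e \<subseteq> W}. lam ^ n)" by simp
  also have "\<dots> \<le> (\<Sum>e\<in>{e \<in> R U. vs e \<subseteq> W}. chain_count R vs n (U \<union> vs e) W)"
    using a Suc.prems by (intro sum_mono Suc.IH card_Un_le_step) auto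
  finally show ?case by simp
qed

lemma markov_binomial_subset:
  fixes f :: "'a set \<Rightarrow> real"
  assumes V: "finite V" and f: "\<And>W. f W \<ge> 0" and c: "c > 0"
  shows "measure_pmf.prob (binomial_subset V p) {W. f W \<ge> c} \<le>
    measure_pmf.expectation (binomial_subset V p) f / c"
  using integral_Markov_inequality_measure[of "binomial_subset V p" f "{}" c]
    integrable_binomial_subset[OF V, of p f] f c by simp

text \<open>Markov's inequality for \<open>chain_count\<close> at the threshold
  \<open>lam ^ t\<close>, which every member of \<open>Q\<close> reaches. The bound decays in
  \<open>t\<close> when the number \<open>lam\<close> of available items exceeds the conditional
  expected number \<Lambda>.\<close>

lemma prob_extendable_le:
  fixes p \<Lambda> lam :: real
  assumes V: "finite V" and p: "0 \<le> p" "p \<le> 1"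
    and vs: "\<And>U e. e \<in> R U \<Longrightarrow> vs e \<subseteq> V \<and> card (vs e) \<le> a"
    and fin: "\<And>U. finite (R U)"
    and wt: "\<And>U. U \<subseteq> V \<Longrightarrow> card U \<le> a * t \<Longrightarrow> (\<Sum>e\<in>R U. p ^ card (vs e - U)) \<le> \<Lambda>"
    and lam: "lam > 0"
    and Q: "\<And>W U. W \<subseteq> V \<Longrightarrow> W \<in> Q \<Longrightarrow> U \<subseteq> W \<Longrightarrow> card U \<le> a * t \<Longrightarrow>
        lam \<le> card {e \<in> R U. vs e \<subseteq> W}"
  shows "measure_pmf.prob (binomial_subset V p) Q \<le> (\<Lambda> / lam) ^ t"
proof -
  let ?P = "binomial_subset V p"
  have "0 \<le> (\<Sum>e\<in>R {}. p ^ card (vs e - {}))" using p by (intro sum_nonneg) auto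
  also have "\<dots> \<le> \<Lambda>" by (intro wt) auto
  finally have \<Lambda>: "\<Lambda> \<ge> 0" .
  \<comment> \<open>Passing to the support supplies \<open>W \<subseteq> V\<close>, which the
    assumption on \<open>Q\<close> requires.\<close>
  have "measure_pmf.prob ?P Q = measure_pmf.prob ?P (Q \<inter> set_pmf ?P)"
    by (simp add: measure_Int_set_pmf)
  also have "\<dots> \<le> measure_pmf.prob ?P {W. chain_count R vs t {} W \<ge> lam ^ t}"
  proof (intro measure_pmf.finite_measure_mono subsetI CollectI)
    fix W assume W: "W \<in> Q \<inter> set_pmf ?P"
    then have WV: "W \<subseteq> V" using set_binomial_subset[OF V] by blast
    show "lam ^ t \<le> chain_count R vs t {} W"
      using Q[OF WV] W vs lam by (intro chain_count_ge[where l = "a * t" and a = a]) auto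
  qed simp
  also have "\<dots> \<le> measure_pmf.expectation ?P (chain_count R vs t {}) / lam ^ t"
    using lam by (intro markov_binomial_subset V chain_count_nonneg) auto
  also have "measure_pmf.expectation ?P (chain_count R vs t {}) \<le> \<Lambda> ^ t"
    using expectation_chain_count_le[of V p R vs a "a * t" \<Lambda> "{}" t, OF V p vs fin wt \<Lambda>] by simp
  finally show ?thesis using lam by (simp add: power_divide divide_right_mono)
qed

section \<open>Weights of edges in hypergraphs of bounded degree\<close>

lemma card_subsets_le: "finite A \<Longrightarrow> card {T. T \<subseteq> A \<and> card T = n} \<le> card A ^ n"
  by (cases "n \<le> card A") (auto simp: n_subsets binomial_le_pow binomial_eq_0)

locale sparse_hypergraph =
  fixes H :: "'a hypergraph" and k q :: nat and N D p :: real
  assumes q_pos: "1 \<le> q" and q_less: "q < k"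
    and fin_H: "finite_hypergraph H" and unif_H: "uniform k H"
    and num_verts_le: "real (num_verts H) \<le> N"
    and max_degree_le: "real (max_degree q H) \<le> D" and D_pos: "D > 0"
    and p_pos: "0 < p" and p_le_1: "p \<le> 1"
begin

abbreviation V where "V \<equiv> verts H"
abbreviation E where "E \<equiv> edges H"

definition \<mu> :: real where "\<mu> = card E * p ^ k"
definition x :: real where "x = N * p powr (k / q)"

lemma finite_V: "finite V" using fin_H by (simp add: finite_hypergraph_def)

lemma edge_subset: "f \<in> E \<Longrightarrow> f \<subseteq> V" using fin_H by (simp add: finite_hypergraph_def)

lemma finite_E: "finite E"
  using edge_subset finite_V by (auto intro: finite_subset[of _ "Pow V"])

lemma finite_edge: "f \<in> E \<Longrightarrow> finite f"
  using edge_subset finite_V by (auto intro: finite_subset)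

lemma card_edge: "f \<in> E \<Longrightarrow> card f = k" using unif_H by (simp add: uniform_def)

lemma N_nonneg: "N \<ge> 0" using num_verts_le by linarith

lemma card_V_le: "real (card V) \<le> N" using num_verts_le by (simp add: num_verts_def)

lemma x_nonneg: "x \<ge> 0" using N_nonneg by (simp add: x_def)

lemma x_power: "x ^ q = N ^ q * p ^ k"
  using q_pos p_pos by (simp add: x_def power_mult_distrib powr_power powr_realpow)

lemma degree_le:
  assumes "U \<subseteq> V" "card U = q"
  shows "real (card {f \<in> E. U \<subseteq> f}) \<le> D"
proof -
  have "card {f \<in> E. U \<subseteq> f} \<le> max_degree q H"
    unfolding max_degree_def using assms finite_V by (intro Max_ge) auto
  then show ?thesis using max_degree_le by linarith
qed

text \<open>Union bound, as each \<open>q\<close>-set lies in at most \<open>D\<close> edges. Later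
  edge counts reduce to finding a small family of \<open>q\<close>-sets that meets every counted
  edge in one of its \<open>q\<close>-subsets.\<close>

lemma card_edges_covered_le:
  assumes F: "F \<subseteq> E" and fin: "finite \<U>"
    and \<U>: "\<And>f. f \<in> F \<Longrightarrow> \<exists>U\<in>\<U>. U \<subseteq> f \<and> card U = q"
  shows "real (card F) \<le> D * card \<U>"
proof -
  let ?\<U> = "{U \<in> \<U>. U \<subseteq> V \<and> card U = q}"
  have sub: "F \<subseteq> (\<Union>U\<in>?\<U>. {f \<in> E. U \<subseteq> f})"
  proof
    fix f assume f: "f \<in> F"
    then obtain U where "U \<in> \<U>" "U \<subseteq> f" "card U = q" using \<U> by blast
    moreover have "f \<in> E" "f \<subseteq> V" using f F edge_subset by auto
    ultimately show "f \<in> (\<Union>U\<in>?\<U>. {f \<in> E. U \<subseteq> f})" by blast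
  qed
  have "card F \<le> card (\<Union>U\<in>?\<U>. {f \<in> E. U \<subseteq> f})"
    using fin finite_E by (intro card_mono sub) auto
  also have "\<dots> \<le> (\<Sum>U\<in>?\<U>. card {f \<in> E. U \<subseteq> f})"
    using fin by (intro card_UN_le) auto
  finally have "real (card F) \<le> (\<Sum>U\<in>?\<U>. real (card {f \<in> E. U \<subseteq> f}))"
    by (simp only: of_nat_le_iff of_nat_sum[symmetric])
  also have "\<dots> \<le> (\<Sum>U\<in>?\<U>. D)" by (intro sum_mono degree_le) auto
  also have "\<dots> = D * card ?\<U>" by simp
  also have "\<dots> \<le> D * card \<U>"
    using D_pos fin by (intro mult_left_mono) (auto intro!: card_mono)
  finally show ?thesis .
qed

lemma card_edges_inside_le:
  assumes U: "finite U"
  shows "real (card {f \<in> E. f \<subseteq> U}) \<le> D * real (card U) ^ q"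
proof -
  have "real (card {f \<in> E. f \<subseteq> U}) \<le> D * card {T. T \<subseteq> U \<and> card T = q}"
  proof (rule card_edges_covered_le)
    fix f assume f: "f \<in> {f \<in> E. f \<subseteq> U}"
    then have "q \<le> card f" using card_edge q_less by auto
    then obtain T where "T \<subseteq> f" "card T = q" by (rule obtain_subset_with_card_n)
    then show "\<exists>T\<in>{T. T \<subseteq> U \<and> card T = q}. T \<subseteq> f \<and> card T = q" using f by blast
  qed (use U in auto)
  also have "\<dots> \<le> D * real (card U ^ q)"
    using D_pos card_subsets_le[OF U] by (intro mult_left_mono) auto
  finally show ?thesis by simp
qed

lemma \<mu>_le: "\<mu> \<le> D * x ^ q"
proof -
  have "{f \<in> E. f \<subseteq> V} = E" using edge_subset by auto
  then have "real (card E) \<le> D * real (card V) ^ q"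
    using card_edges_inside_le[OF finite_V] by simp
  also have "\<dots> \<le> D * N ^ q" using D_pos card_V_le by (intro mult_left_mono power_mono) auto
  finally show ?thesis using p_pos by (simp add: \<mu>_def x_power mult_right_mono)
qed

text \<open>Each counted edge contains a \<open>q\<close>-set formed by one vertex of
  \<open>B\<close>, \<open>i - 1\<close> further vertices of \<open>A\<close> and
  \<open>q - i\<close> further vertices of \<open>V\<close>. Taking as many vertices as possible
  from \<open>A\<close> keeps the power of \<open>N\<close> low.\<close>

lemma card_edges_touching_le:
  assumes A: "A \<subseteq> V" and B: "B \<subseteq> A" and j: "1 \<le> j" and i: "i = min j q"
  shows "real (card {g \<in> E. g \<inter> B \<noteq> {} \<and> card (g \<inter> A) = j})
      \<le> D * (card B * real (card A) ^ (i - 1) * N ^ (q - i))" (is "real (card ?F) \<le> _")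
proof -
  let ?P = "\<lambda>S n. {T. T \<subseteq> S \<and> card T = n}"
  let ?I = "B \<times> ?P A (i - 1) \<times> ?P V (q - i)"
  have finA: "finite A" and finB: "finite B" using A B finite_V by (auto intro: finite_subset)
  have finI: "finite ?I" using finA finB finite_V by auto
  have i1: "1 \<le> i" "i \<le> j" "i \<le> q" using i j q_pos by auto
  have "real (card ?F) \<le> D * card ((\<lambda>(b, T, T'). insert b (T \<union> T')) ` ?I)"
  proof (rule card_edges_covered_le)
    fix g assume g: "g \<in> ?F"
    then obtain b where b: "b \<in> g" "b \<in> B" by auto
    have fg: "finite g" using g finite_edge by auto
    have "i - 1 \<le> card (g \<inter> A - {b})"
      using g b B i1 fg by (auto simp: card_Diff_singleton_if)
    then obtain T where T: "T \<subseteq> g \<inter> A - {b}" "card T = i - 1" "finite T"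
      by (rule obtain_subset_with_card_n)
    have cbT: "card (insert b T) = i"
      using T i1 by (subst card_insert_disjoint) auto
    have "card (g - insert b T) = k - i"
      using cbT T b g fg card_edge by (subst card_Diff_subset) auto
    then have "q - i \<le> card (g - insert b T)" using q_less by simp
    then obtain T' where T': "T' \<subseteq> g - insert b T" "card T' = q - i" "finite T'"
      by (rule obtain_subset_with_card_n)
    have "card (insert b T \<union> T') = q"
      using T T' cbT i1 by (subst card_Un_disjoint) auto
    moreover have "insert b (T \<union> T') \<subseteq> g" using T T' b by auto
    moreover have "(b, T, T') \<in> ?I" using T T' b g edge_subset by auto
    ultimately show "\<exists>U\<in>(\<lambda>(b, T, T'). insert b (T \<union> T')) ` ?I. U \<subseteq> g \<and> card U = q"
      by (intro bexI[of _ "insert b (T \<union> T')"] image_eqI[of _ _ "(b, T, T')"]) simp_all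
  qed (use finI in auto)
  also have "\<dots> \<le> D * card ?I"
    using D_pos finI by (intro mult_left_mono) (auto intro: card_image_le)
  also have "real (card ?I) = card B * (real (card (?P A (i - 1))) * real (card (?P V (q - i))))"
    by (simp add: card_cartesian_product)
  also have "\<dots> \<le> card B * (real (card A) ^ (i - 1) * N ^ (q - i))"
  proof (intro mult_left_mono mult_mono)
    show "real (card (?P A (i - 1))) \<le> real (card A) ^ (i - 1)"
      by (metis card_subsets_le[OF finA] of_nat_le_iff of_nat_power)
    have "real (card (?P V (q - i))) \<le> real (card V) ^ (q - i)"
      by (metis card_subsets_le[OF finite_V] of_nat_le_iff of_nat_power)
    also have "\<dots> \<le> N ^ (q - i)" using card_V_le by (intro power_mono) auto
    finally show "real (card (?P V (q - i))) \<le> N ^ (q - i)" .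
  qed auto
  finally show ?thesis using D_pos by (simp add: mult_ac)
qed

text \<open>For \<open>j \<le> q\<close>, substituting \<open>N = x * p powr (- (k / q))\<close>
  leaves \<open>p\<close> with exponent \<open>j * (k - q) / q\<close>, at least
  \<open>1 / q\<close> because \<open>q < k\<close>. For \<open>j > q\<close> no power of
  \<open>N\<close> remains, and \<open>k - j\<close> is at least 1 unless
  \<open>j = k\<close>.\<close>

lemma N_power_le:
  assumes j: "1 \<le> j" "j \<le> k" and i: "i = min j q"
  shows "N ^ (q - i) * p ^ (k - j) \<le> x ^ (q - i) * (if j < k then p powr (1 / k) else 1)"
proof (cases "j \<le> q")
  case True
  have N: "N = x * p powr (- (k / q))"
    using p_pos by (simp add: x_def powr_minus field_simps)
  have ex: "- (k / q) * real (q - j) + real (k - j) = real j * (real k - real q) / real q"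
    using True q_less q_pos by (simp add: field_simps)
  have "1 / real k \<le> 1 / real q" using q_pos q_less by (simp add: frac_le)
  also have "\<dots> \<le> real j * (real k - real q) / real q"
    using q_less j mult_mono[of 1 "real j" 1 "real k - real q"] by (intro divide_right_mono) auto
  finally have le: "1 / real k \<le> real j * (real k - real q) / real q" .
  have "N ^ (q - j) * p ^ (k - j) =
      x ^ (q - j) * (p powr (- (k / q) * real (q - j)) * p powr real (k - j))"
    using p_pos by (subst N) (simp add: power_mult_distrib powr_power powr_realpow mult_ac)
  also have "\<dots> = x ^ (q - j) * p powr (real j * (real k - real q) / real q)"
    by (simp only: powr_add[symmetric] ex)
  also have "\<dots> \<le> x ^ (q - j) * p powr (1 / real k)"
    using le p_pos p_le_1 x_nonneg by (intro mult_left_mono powr_mono') auto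
  finally show ?thesis using True i q_less by simp
next
  case False
  have "p ^ (k - j) \<le> p powr (1 / real k)" if "j < k"
  proof -
    have "p ^ (k - j) = p powr real (k - j)" using p_pos by (simp add: powr_realpow)
    also have "\<dots> \<le> p powr (1 / real k)"
    proof (intro powr_mono')
      have "1 / real k \<le> 1" using that by simp
      also have "1 \<le> real (k - j)" using that by simp
      finally show "1 / real k \<le> real (k - j)" .
    qed (use p_pos p_le_1 in auto)
    finally show ?thesis .
  qed
  then show ?thesis using False i j by simp
qed

text \<open>Each edge weighs \<open>p ^ (k - j)\<close>. Of the \<open>q\<close> factors in the edge
  count one is \<open>card B\<close>; of the others, \<open>i - 1\<close> come from \<open>A\<close>
  and \<open>q - i\<close> from \<open>N\<close>, the latter being traded for \<open>x\<close> by
  \<open>N_power_le\<close>. Both kinds are at most \<open>y\<close>.\<close>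

lemma weight_touching_le:
  fixes y :: real
  assumes A: "A \<subseteq> V" and B: "B \<subseteq> A" and y: "real (card A) \<le> y" "x \<le> y" and j: "1 \<le> j" "j \<le> k"
  shows "(\<Sum>g\<in>{g \<in> E. g \<inter> B \<noteq> {} \<and> card (g \<inter> A) = j}. p ^ card (g - A))
      \<le> D * card B * y ^ (q - 1) * (if j < k then p powr (1 / k) else 1)"
    (is "sum ?w ?F \<le> _ * ?r")
proof -
  define i where "i = min j q"
  have i: "i - 1 + (q - i) = q - 1" using j q_pos by (auto simp: i_def)
  have r: "?r \<ge> 0" by simp
  have "sum ?w ?F = (\<Sum>g\<in>?F. p ^ (k - j))"
  proof (intro sum.cong refl)
    fix g assume g: "g \<in> ?F"
    then have "card (g - A) = k - j"
      using finite_edge card_edge card_Diff_subset_Int[of g A] by auto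
    then show "p ^ card (g - A) = p ^ (k - j)" by simp
  qed
  also have "\<dots> = card ?F * p ^ (k - j)" by simp
  also have "\<dots> \<le> D * (card B * real (card A) ^ (i - 1) * N ^ (q - i)) * p ^ (k - j)"
    using card_edges_touching_le[OF A B j(1) i_def] p_pos by (intro mult_right_mono) auto
  also have "\<dots> = D * card B * (real (card A) ^ (i - 1) * (N ^ (q - i) * p ^ (k - j)))"
    by simp
  also have "\<dots> \<le> D * card B * (y ^ (i - 1) * (y ^ (q - i) * ?r))"
  proof (rule mult_left_mono[OF mult_mono])
    have "N ^ (q - i) * p ^ (k - j) \<le> x ^ (q - i) * ?r" by (rule N_power_le[OF j i_def])
    also have "\<dots> \<le> y ^ (q - i) * ?r"
      using y x_nonneg by (intro mult_right_mono power_mono r) auto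
    finally show "N ^ (q - i) * p ^ (k - j) \<le> y ^ (q - i) * ?r" .
  qed (use y x_nonneg N_nonneg p_pos D_pos in \<open>auto intro!: power_mono\<close>)
  also have "\<dots> = D * card B * (y ^ (i - 1 + (q - i)) * ?r)"
    by (simp add: power_add mult_ac)
  finally show ?thesis unfolding i by (simp add: mult_ac)
qed

text \<open>Sum over \<open>j = card (g \<inter> A)\<close>. Meeting \<open>B \<subseteq> A\<close>
  forces \<open>j \<ge> 1\<close>; not lying in \<open>A\<close> forces \<open>j < k\<close>, the
  case in which \<open>p powr (1 / k)\<close> is gained.\<close>

lemma weight_meeting_le:
  fixes y :: real
  assumes A: "A \<subseteq> V" and B: "B \<subseteq> A" and y: "real (card A) \<le> y" "x \<le> y"
  shows "(\<Sum>g\<in>{g \<in> E. g \<inter> B \<noteq> {}}. p ^ card (g - A)) \<le> k * D * card B * y ^ (q - 1)" (is ?th1)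
    and "(\<Sum>g\<in>{g \<in> E. g \<inter> B \<noteq> {} \<and> \<not> g \<subseteq> A}. p ^ card (g - A))
      \<le> k * D * card B * y ^ (q - 1) * p powr (1 / k)" (is ?th2)
proof -
  have y0: "y \<ge> 0" using y x_nonneg by linarith
  have r1: "p powr (1 / k) \<le> 1" using p_pos p_le_1 by (simp add: powr_le1)
  have pos: "card (g \<inter> A) \<ge> 1" if "g \<in> E" "g \<inter> B \<noteq> {}" for g
    using that B finite_edge[of g] by (auto simp: Suc_le_eq card_gt_0_iff)
  have le: "card (g \<inter> A) \<le> k" if "g \<in> E" for g
    using card_mono[of g "g \<inter> A"] finite_edge[OF that] card_edge[OF that] by auto
  have less: "card (g \<inter> A) < k" if "g \<in> E" "\<not> g \<subseteq> A" for g
    using psubset_card_mono[of g "g \<inter> A"] finite_edge card_edge that by auto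
  have "(\<Sum>g\<in>{g \<in> E. g \<inter> B \<noteq> {}}. p ^ card (g - A)) =
      (\<Sum>j\<in>{1..k}. \<Sum>g\<in>{g \<in> {g \<in> E. g \<inter> B \<noteq> {}}. card (g \<inter> A) = j}. p ^ card (g - A))"
  proof (rule sum.group[symmetric])
    show "(\<lambda>g. card (g \<inter> A)) ` {g \<in> E. g \<inter> B \<noteq> {}} \<subseteq> {1..k}"
    proof (intro image_subsetI)
      fix g assume "g \<in> {g \<in> E. g \<inter> B \<noteq> {}}"
      then show "card (g \<inter> A) \<in> {1..k}" using pos[of g] le[of g] by simp
    qed
  qed (use finite_E in auto)
  also have "\<dots> \<le> (\<Sum>j\<in>{1..k}. D * card B * y ^ (q - 1))"
  proof (intro sum_mono)
    fix j assume j: "j \<in> {1..k}"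
    have "(\<Sum>g\<in>{g \<in> E. g \<inter> B \<noteq> {} \<and> card (g \<inter> A) = j}. p ^ card (g - A))
        \<le> D * card B * y ^ (q - 1) * (if j < k then p powr (1 / k) else 1)"
      using j by (intro weight_touching_le A B y) auto
    also have "\<dots> \<le> D * card B * y ^ (q - 1) * 1"
      using D_pos y0 r1 by (intro mult_left_mono) auto
    finally show "(\<Sum>g\<in>{g \<in> {g \<in> E. g \<inter> B \<noteq> {}}. card (g \<inter> A) = j}. p ^ card (g - A))
        \<le> D * card B * y ^ (q - 1)" by simp
  qed
  finally show ?th1 by (simp add: mult_ac)
  let ?F = "{g \<in> E. g \<inter> B \<noteq> {} \<and> \<not> g \<subseteq> A}"
  have "(\<Sum>g\<in>?F. p ^ card (g - A)) = (\<Sum>j\<in>{1..<k}. \<Sum>g\<in>{g \<in> ?F. card (g \<inter> A) = j}. p ^ card (g - A))"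
  proof (rule sum.group[symmetric])
    show "(\<lambda>g. card (g \<inter> A)) ` ?F \<subseteq> {1..<k}"
    proof (intro image_subsetI)
      fix g assume "g \<in> ?F"
      then show "card (g \<inter> A) \<in> {1..<k}" using pos[of g] less[of g] by simp
    qed
  qed (use finite_E in auto)
  also have "\<dots> \<le> (\<Sum>j\<in>{1..<k}. D * card B * y ^ (q - 1) * p powr (1 / k))"
  proof (intro sum_mono)
    fix j assume j: "j \<in> {1..<k}"
    have "(\<Sum>g\<in>{g \<in> ?F. card (g \<inter> A) = j}. p ^ card (g - A)) \<le>
        (\<Sum>g\<in>{g \<in> E. g \<inter> B \<noteq> {} \<and> card (g \<inter> A) = j}. p ^ card (g - A))"
      using finite_E p_pos by (intro sum_mono2) auto
    also have "\<dots> \<le> D * card B * y ^ (q - 1) * (if j < k then p powr (1 / k) else 1)"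
      using j by (intro weight_touching_le A B y) auto
    finally show "(\<Sum>g\<in>{g \<in> ?F. card (g \<inter> A) = j}. p ^ card (g - A)) \<le>
        D * card B * y ^ (q - 1) * p powr (1 / k)" using j by simp
  qed
  also have "\<dots> = real (k - 1) * (D * card B * y ^ (q - 1) * p powr (1 / k))" by simp
  also have "\<dots> \<le> real k * (D * card B * y ^ (q - 1) * p powr (1 / k))"
    using D_pos y0 by (intro mult_right_mono) auto
  finally show ?th2 by (simp add: mult_ac)
qed

end

section \<open>Pairs of intersecting edges\<close>

text \<open>Cauchy-Schwarz for the vertex degrees in \<open>J\<close>: they sum to
  \<open>k * card J\<close>, and their squares sum to the total size of all
  \<open>f \<inter> g\<close>, at most \<open>k\<close> per intersecting ordered pair.\<close>

lemma intersecting_pairs_ge: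
  assumes S: "finite S" and J: "\<And>f. f \<in> J \<Longrightarrow> f \<subseteq> S \<and> card f = k" and k: "k > 0"
  shows "real k * (real (card J))\<^sup>2 \<le> card S * card {(f, g) \<in> J \<times> J. f \<inter> g \<noteq> {}}"
proof -
  have "J \<subseteq> Pow S" using J by auto
  then have finJ: "finite J" using S by (auto intro: finite_subset)
  have finJ': "finite f" if "f \<in> J" for f using J[OF that] S by (auto intro: finite_subset)
  let ?d = "\<lambda>v. \<Sum>f\<in>J. of_bool (v \<in> f) :: real"
  have card_eq: "(\<Sum>v\<in>S. of_bool (v \<in> A)) = real (card A)" if "A \<subseteq> S" for A
    using that S by (simp add: sum.If_cases of_bool_def Int_absorb1)
  have "(\<Sum>v\<in>S. ?d v) = (\<Sum>f\<in>J. \<Sum>v\<in>S. of_bool (v \<in> f))" by (rule sum.swap)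
  also have "\<dots> = (\<Sum>f\<in>J. real k)" using J card_eq by (intro sum.cong) auto
  finally have deg: "(\<Sum>v\<in>S. ?d v) = real k * card J" by (simp add: mult.commute)
  have "(\<Sum>v\<in>S. (?d v)\<^sup>2) = (\<Sum>v\<in>S. \<Sum>f\<in>J. \<Sum>g\<in>J. of_bool (v \<in> f \<inter> g))"
    by (simp add: power2_eq_square sum_product of_bool_conj)
  also have "\<dots> = (\<Sum>f\<in>J. \<Sum>g\<in>J. \<Sum>v\<in>S. of_bool (v \<in> f \<inter> g))"
    by (subst sum.swap, intro sum.cong refl sum.swap)
  also have "\<dots> = (\<Sum>f\<in>J. \<Sum>g\<in>J. real (card (f \<inter> g)))"
    using J by (intro sum.cong refl card_eq) auto
  also have "\<dots> \<le> (\<Sum>f\<in>J. \<Sum>g\<in>J. if f \<inter> g \<noteq> {} then real k else 0)"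
  proof (intro sum_mono)
    fix f g assume "f \<in> J" "g \<in> J"
    then show "real (card (f \<inter> g)) \<le> (if f \<inter> g \<noteq> {} then real k else 0)"
      using J[of f] finJ'[of f] card_mono[of f "f \<inter> g"] by auto
  qed
  also have "\<dots> = (\<Sum>(f, g)\<in>J \<times> J. if f \<inter> g \<noteq> {} then real k else 0)"
    by (simp add: sum.cartesian_product)
  also have "\<dots> = (\<Sum>z\<in>{(f, g) \<in> J \<times> J. f \<inter> g \<noteq> {}}. real k)"
  proof (rule sum.mono_neutral_cong_right)
    fix z assume "z \<in> {(f, g) \<in> J \<times> J. f \<inter> g \<noteq> {}}"
    then show "(case z of (f, g) \<Rightarrow> if f \<inter> g \<noteq> {} then real k else 0) = real k"
      by (cases z) simp
  qed (use finJ in auto)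
  finally have sq: "(\<Sum>v\<in>S. (?d v)\<^sup>2) \<le> real k * card {(f, g) \<in> J \<times> J. f \<inter> g \<noteq> {}}"
    by (simp add: mult.commute)
  have "(real k * card J)\<^sup>2 \<le> (\<Sum>v\<in>S. (?d v)\<^sup>2) * card S"
    unfolding deg[symmetric] by (rule sum_squared_le_sum_of_squares)
  also have "\<dots> \<le> real k * card {(f, g) \<in> J \<times> J. f \<inter> g \<noteq> {}} * card S"
    by (intro mult_right_mono sq) auto
  finally have "real k * (real k * (real (card J))\<^sup>2) \<le>
      real k * (card S * card {(f, g) \<in> J \<times> J. f \<inter> g \<noteq> {}})"
    by (simp add: power2_eq_square mult_ac)
  then show ?thesis using k by simp
qed

text \<open>Discards the diagonal from the previous count. As \<open>2 * m \<le> card J\<close>, the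
  diagonal accounts for at most half of it.\<close>

lemma distinct_intersecting_pairs_ge:
  assumes S: "finite S" and J: "\<And>f. f \<in> J \<Longrightarrow> f \<subseteq> S \<and> card f = k" and k: "k > 0"
    and m: "card S \<le> k * m" "2 * real m \<le> card J" and J0: "J \<noteq> {}"
  shows "(real (card J))\<^sup>2 / (2 * m) \<le> card {(f, g) \<in> J \<times> J. f \<noteq> g \<and> f \<inter> g \<noteq> {}}"
proof -
  have "J \<subseteq> Pow S" using J by auto
  then have finJ: "finite J" using S by (auto intro: finite_subset)
  obtain f where "f \<in> J" using J0 by blast
  then have "f \<noteq> {}" "f \<subseteq> S" using J[of f] k by auto
  then have "card S > 0" using S by (auto simp: card_gt_0_iff)
  then have m0: "m > 0" using m by (cases m) auto
  define P where "P = {(f, g) \<in> J \<times> J. f \<inter> g \<noteq> {}}"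
  define P' where "P' = {(f, g) \<in> J \<times> J. f \<noteq> g \<and> f \<inter> g \<noteq> {}}"
  have finP': "finite P'" unfolding P'_def using finJ by (auto intro: finite_subset[of _ "J \<times> J"])
  have "P \<subseteq> P' \<union> (\<lambda>f. (f, f)) ` J" by (auto simp: P_def P'_def)
  then have "card P \<le> card (P' \<union> (\<lambda>f. (f, f)) ` J)" using finP' finJ by (intro card_mono) auto
  also have "\<dots> \<le> card P' + card ((\<lambda>f. (f, f)) ` J)" by (rule card_Un_le)
  also have "\<dots> \<le> card P' + card J" using card_image_le[OF finJ] by auto
  finally have P: "real (card P) \<le> card P' + card J" by simp
  have "real k * (real (card J))\<^sup>2 \<le> card S * card P"
    unfolding P_def by (intro intersecting_pairs_ge S J k)
  also have "\<dots> \<le> real k * (m * card P)"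
    using m(1) by (metis mult.assoc mult_right_mono of_nat_0_le_iff of_nat_le_iff of_nat_mult)
  finally have "(real (card J))\<^sup>2 \<le> real m * card P" using k by simp
  also have "\<dots> \<le> real m * (real (card P') + card J)" using P by (intro mult_left_mono) auto
  also have "\<dots> = real m * card P' + real m * card J" by (simp add: distrib_left)
  also have "real m * card J \<le> (real (card J))\<^sup>2 / 2"
    using m(2) mult_right_mono[of "2 * real m" "real (card J)" "real (card J)"]
    by (simp add: power2_eq_square)
  finally have "(real (card J))\<^sup>2 \<le> 2 * m * card P'" by simp
  then show ?thesis unfolding P'_def[symmetric] using m0 by (simp add: field_simps)
qed

lemma sum_Un_le:
  fixes f :: "'b \<Rightarrow> real"
  assumes "finite A" "finite B" "\<And>z. f z \<ge> 0"
  shows "sum f (A \<union> B) \<le> sum f A + sum f B"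
  using sum.union_inter[OF assms(1,2), of f] sum_nonneg[of "A \<inter> B" f] assms(3) by simp

section \<open>Expected edge count, and weights of edges and pairs relative to an occupied
  set\<close>

context sparse_hypergraph
begin

lemma k_pos: "k > 0" using q_less by simp

lemma \<mu>_nonneg: "\<mu> \<ge> 0" using p_pos by (simp add: \<mu>_def)

lemma num_edges_induced: "num_edges (induced H W) = card {f \<in> E. f \<subseteq> W}"
  by (simp add: num_edges_def induced_def)

lemma expectation_num_edges:
  "measure_pmf.expectation (binomial_subset V p) (\<lambda>W. real (num_edges (induced H W))) = \<mu>"
proof -
  have "measure_pmf.expectation (binomial_subset V p) (\<lambda>W. real (num_edges (induced H W))) =
      measure_pmf.expectation (binomial_subset V p) (\<lambda>W. \<Sum>f\<in>E. indicat_real {W. f \<subseteq> W} W)"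
    using finite_E
    by (intro Bochner_Integration.integral_cong refl)
      (simp add: num_edges_induced indicator_def sum.If_cases Int_def)
  also have "\<dots> = (\<Sum>f\<in>E. measure_pmf.prob (binomial_subset V p) {W. f \<subseteq> W})"
    by (subst Bochner_Integration.integral_sum)
      (auto intro: integrable_binomial_subset finite_V)
  also have "\<dots> = (\<Sum>f\<in>E. p ^ k)"
    using p_pos p_le_1 edge_subset card_edge finite_V
    by (intro sum.cong) (auto simp: prob_superset_binomial_subset)
  finally show ?thesis by (simp add: \<mu>_def)
qed

text \<open>Edges disjoint from \<open>U\<close> weigh at most \<mu> in total; the others are
  handled by \<open>weight_meeting_le\<close> with \<open>A = B = U\<close>.\<close>

lemma weight_edges_le:
  fixes y :: real
  assumes U: "U \<subseteq> V" and y: "real (card U) \<le> y" "x \<le> y"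
  shows "(\<Sum>f\<in>E. p ^ card (f - U)) \<le> \<mu> + k * D * card U * y ^ (q - 1)"
    and "(\<Sum>f\<in>{f \<in> E. \<not> f \<subseteq> U}. p ^ card (f - U))
      \<le> \<mu> + k * D * card U * y ^ (q - 1) * p powr (1 / k)"
proof -
  have disj: "(\<Sum>f\<in>{f \<in> E. f \<inter> U = {}}. p ^ card (f - U)) \<le> \<mu>"
  proof -
    have "(\<Sum>f\<in>{f \<in> E. f \<inter> U = {}}. p ^ card (f - U)) = (\<Sum>f\<in>{f \<in> E. f \<inter> U = {}}. p ^ k)"
      using card_edge by (intro sum.cong) (auto simp: Diff_triv)
    also have "\<dots> \<le> (\<Sum>f\<in>E. p ^ k)" using finite_E p_pos by (intro sum_mono2) auto
    finally show ?thesis by (simp add: \<mu>_def)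
  qed
  have "(\<Sum>f\<in>E. p ^ card (f - U)) = (\<Sum>f\<in>{f \<in> E. f \<inter> U = {}}. p ^ card (f - U))
      + (\<Sum>f\<in>{f \<in> E. f \<inter> U \<noteq> {}}. p ^ card (f - U))"
    using finite_E by (subst sum.union_disjoint[symmetric]) (auto intro: sum.cong)
  then show "(\<Sum>f\<in>E. p ^ card (f - U)) \<le> \<mu> + k * D * card U * y ^ (q - 1)"
    using disj weight_meeting_le(1)[OF U subset_refl y] by simp
  have "(\<Sum>f\<in>{f \<in> E. \<not> f \<subseteq> U}. p ^ card (f - U)) \<le> (\<Sum>f\<in>{f \<in> E. f \<inter> U = {}} \<union>
      {f \<in> E. f \<inter> U \<noteq> {} \<and> \<not> f \<subseteq> U}. p ^ card (f - U))"
    using finite_E p_pos by (intro sum_mono2) auto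
  also have "\<dots> = (\<Sum>f\<in>{f \<in> E. f \<inter> U = {}}. p ^ card (f - U))
      + (\<Sum>f\<in>{f \<in> E. f \<inter> U \<noteq> {} \<and> \<not> f \<subseteq> U}. p ^ card (f - U))"
    using finite_E by (intro sum.union_disjoint) auto
  finally show "(\<Sum>f\<in>{f \<in> E. \<not> f \<subseteq> U}. p ^ card (f - U))
      \<le> \<mu> + k * D * card U * y ^ (q - 1) * p powr (1 / k)"
    using disj weight_meeting_le(2)[OF U subset_refl y] by simp
qed

text \<open>Pairs are ordered. In a uniform hypergraph \<open>f \<noteq> g\<close> prevents either
  edge from containing the other, so an edge that meets the other one still needs a vertex outside
  it.\<close>

definition fresh_pairs :: "'a set \<Rightarrow> ('a set \<times> 'a set) set" where
  "fresh_pairs U = {(f, g) \<in> E \<times> E. f \<noteq> g \<and> f \<inter> g \<noteq> {} \<and> \<not> f \<subseteq> U \<and> \<not> g \<subseteq> U}"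

lemma finite_fresh_pairs: "finite (fresh_pairs U)"
  unfolding fresh_pairs_def using finite_E by (auto intro: finite_subset[of _ "E \<times> E"])

text \<open>Makes the weight of a pair factor: first expose \<open>f\<close> relative to
  \<open>U\<close>, then \<open>g\<close> relative to \<open>U \<union> f\<close>.\<close>

lemma card_Un_Diff:
  assumes "f \<in> E" "g \<in> E"
  shows "card (f \<union> g - U) = card (f - U) + card (g - (U \<union> f))"
proof -
  have "f \<union> g - U = (f - U) \<union> (g - (U \<union> f))" by blast
  moreover have "card ((f - U) \<union> (g - (U \<union> f))) = card (f - U) + card (g - (U \<union> f))"
    using assms finite_edge by (intro card_Un_disjoint) auto
  ultimately show ?thesis by simp
qed

text \<open>Every pair gains a factor \<open>p powr (1 / k)\<close>: from an edge that meets \<open>U\<close> without lying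
  in it, or, if neither edge meets \<open>U\<close>, from the second edge, which meets the first.\<close>

lemma weight_fresh_pairs_le:
  assumes U: "U \<subseteq> V" and cU: "real (card U) \<le> x" and kx: "k \<le> x"
  shows "(\<Sum>(f, g)\<in>fresh_pairs U. p ^ card (f \<union> g - U))
    \<le> 3 * k ^ 3 * D\<^sup>2 * x * ((2 * x) ^ (q - 1))\<^sup>2 * p powr (1 / k)"
proof -
  define \<theta> where "\<theta> = p powr (1 / k)"
  define z where "z = (2 * x) ^ (q - 1)"
  have x1: "x \<ge> 1" using kx k_pos by linarith
  have z0: "z \<ge> 0" "\<theta> \<ge> 0" using x1 by (auto simp: z_def \<theta>_def)
  let ?w = "\<lambda>(f, g). p ^ card (f \<union> g - U)"
  \<comment> \<open>The three classes cover \<open>fresh_pairs U\<close>; they may overlap, which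
    only costs a constant.\<close>
  define R1 where "R1 = {(f, g) \<in> fresh_pairs U. f \<inter> U \<noteq> {}}"
  define R2 where "R2 = {(f, g) \<in> fresh_pairs U. g \<inter> U \<noteq> {}}"
  define R3 where "R3 = {(f, g) \<in> fresh_pairs U. f \<inter> U = {} \<and> g \<inter> U = {}}"
  have fin: "finite R1" "finite R2" "finite R3"
    unfolding R1_def R2_def R3_def by (auto intro: finite_subset[OF _ finite_fresh_pairs[of U]])
  have w0: "?w e \<ge> 0" for e using p_pos by (cases e) auto
  \<comment> \<open>No gain is claimed here. The \<open>2 * x\<close> arises because
    \<open>U \<union> f\<close> has at most \<open>x + k\<close> vertices and
    \<open>k \<le> x\<close>.\<close>
  have second: "(\<Sum>g\<in>{g \<in> E. g \<inter> f \<noteq> {}}. p ^ card (g - (U \<union> f))) \<le> k * D * k * z"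
    if f: "f \<in> E" for f
  proof -
    have "card (U \<union> f) \<le> card U + card f" by (rule card_Un_le)
    then have "real (card (U \<union> f)) \<le> 2 * x" using cU kx card_edge[OF f] by simp
    then have "(\<Sum>g\<in>{g \<in> E. g \<inter> f \<noteq> {}}. p ^ card (g - (U \<union> f)))
        \<le> k * D * card f * (2 * x) ^ (q - 1)"
      using U f edge_subset x_nonneg by (intro weight_meeting_le(1)) auto
    then show ?thesis using card_edge[OF f] by (simp add: z_def)
  qed
  have first: "(\<Sum>f\<in>{f \<in> E. f \<inter> U \<noteq> {} \<and> \<not> f \<subseteq> U}. p ^ card (f - U)) \<le> k * D * x * z * \<theta>"
  proof -
    have "(\<Sum>f\<in>{f \<in> E. f \<inter> U \<noteq> {} \<and> \<not> f \<subseteq> U}. p ^ card (f - U))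
        \<le> k * D * card U * (2 * x) ^ (q - 1) * p powr (1 / k)"
      using U cU x_nonneg by (intro weight_meeting_le(2)) auto
    also have "\<dots> \<le> k * D * x * (2 * x) ^ (q - 1) * p powr (1 / k)"
      using cU D_pos x_nonneg by (intro mult_right_mono mult_left_mono) auto
    finally show ?thesis by (simp add: z_def \<theta>_def)
  qed
  have S1: "sum ?w R1 \<le> k * D * x * z * \<theta> * (k * D * k * z)"
  proof -
    let ?F = "{f \<in> E. f \<inter> U \<noteq> {} \<and> \<not> f \<subseteq> U}"
    have "sum ?w R1 \<le> sum ?w (SIGMA f:?F. {g \<in> E. g \<inter> f \<noteq> {}})"
      using finite_E w0 by (intro sum_mono2 finite_SigmaI) (auto simp: R1_def fresh_pairs_def)
    also have "\<dots> = (\<Sum>f\<in>?F. \<Sum>g\<in>{g \<in> E. g \<inter> f \<noteq> {}}. p ^ card (f \<union> g - U))"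
      using finite_E by (subst sum.Sigma) auto
    also have "\<dots> = (\<Sum>f\<in>?F. p ^ card (f - U) * (\<Sum>g\<in>{g \<in> E. g \<inter> f \<noteq> {}}. p ^ card (g - (U \<union> f))))"
      by (intro sum.cong refl) (simp add: sum_distrib_left card_Un_Diff power_add)
    also have "\<dots> \<le> (\<Sum>f\<in>?F. p ^ card (f - U) * (k * D * k * z))"
      using p_pos by (intro sum_mono mult_left_mono second) auto
    also have "\<dots> = (\<Sum>f\<in>?F. p ^ card (f - U)) * (k * D * k * z)"
      by (simp add: sum_distrib_right)
    also have "\<dots> \<le> k * D * x * z * \<theta> * (k * D * k * z)"
      using D_pos z0 by (intro mult_right_mono first) auto
    finally show ?thesis .
  qed
  have "sum ?w R2 = sum ?w R1"
    by (rule sum.reindex_bij_witness[of _ prod.swap prod.swap])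
      (auto simp: R1_def R2_def fresh_pairs_def Un_commute)
  then have S2: "sum ?w R2 \<le> k * D * x * z * \<theta> * (k * D * k * z)" using S1 by simp
  \<comment> \<open>The first edges contribute \<mu> in total, and the gain comes from the second
    edge, which meets \<open>f\<close> without lying in it.\<close>
  have S3: "sum ?w R3 \<le> D * x * z * (k * D * k * z * \<theta>)"
  proof -
    have "sum ?w R3 = (\<Sum>(f, g)\<in>R3. p ^ k * p ^ card (g - f))"
    proof (intro sum.cong refl, clarify)
      fix f g assume "(f, g) \<in> R3"
      then have fg: "f \<in> E" "g \<in> E" "f \<inter> U = {}" "g \<inter> U = {}"
        by (auto simp: R3_def fresh_pairs_def)
      then have "f - U = f" "g - (U \<union> f) = g - f" by auto
      then show "p ^ card (f \<union> g - U) = p ^ k * p ^ card (g - f)"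
        using fg by (simp add: card_Un_Diff card_edge power_add)
    qed
    also have "\<dots> \<le> (\<Sum>(f, g)\<in>(SIGMA f:E. {g \<in> E. g \<inter> f \<noteq> {} \<and> \<not> g \<subseteq> f}). p ^ k * p ^ card (g - f))"
    proof (rule sum_mono2)
      show "R3 \<subseteq> (SIGMA f:E. {g \<in> E. g \<inter> f \<noteq> {} \<and> \<not> g \<subseteq> f})"
      proof clarify
        fix f g assume "(f, g) \<in> R3"
        then have fg: "f \<in> E" "g \<in> E" "f \<noteq> g" "f \<inter> g \<noteq> {}"
          by (auto simp: R3_def fresh_pairs_def)
        then have "\<not> g \<subseteq> f"
          using card_subset_eq[of f g] finite_edge card_edge by auto
        then show "f \<in> E \<and> g \<in> {g \<in> E. g \<inter> f \<noteq> {} \<and> \<not> g \<subseteq> f}" using fg by auto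
      qed
    qed (use finite_E p_pos in auto)
    also have "\<dots> = (\<Sum>f\<in>E. \<Sum>g\<in>{g \<in> E. g \<inter> f \<noteq> {} \<and> \<not> g \<subseteq> f}. p ^ k * p ^ card (g - f))"
      using finite_E by (subst sum.Sigma) auto
    also have "\<dots> = (\<Sum>f\<in>E. p ^ k * (\<Sum>g\<in>{g \<in> E. g \<inter> f \<noteq> {} \<and> \<not> g \<subseteq> f}. p ^ card (g - f)))"
      by (simp add: sum_distrib_left)
    also have "\<dots> \<le> (\<Sum>f\<in>E. p ^ k * (k * D * k * z * \<theta>))"
    proof (intro sum_mono mult_left_mono)
      fix f assume f: "f \<in> E"
      have "(\<Sum>g\<in>{g \<in> E. g \<inter> f \<noteq> {} \<and> \<not> g \<subseteq> f}. p ^ card (g - f))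
          \<le> k * D * card f * (2 * x) ^ (q - 1) * p powr (1 / k)"
        using f edge_subset card_edge kx x_nonneg by (intro weight_meeting_le(2)) auto
      then show "(\<Sum>g\<in>{g \<in> E. g \<inter> f \<noteq> {} \<and> \<not> g \<subseteq> f}. p ^ card (g - f)) \<le> k * D * k * z * \<theta>"
        using card_edge[OF f] by (simp add: z_def \<theta>_def)
    qed (use p_pos in auto)
    also have "\<dots> = \<mu> * (k * D * k * z * \<theta>)" by (simp add: \<mu>_def)
    also have "\<dots> \<le> D * x * z * (k * D * k * z * \<theta>)"
    proof (intro mult_right_mono)
      have "x ^ q = x * x ^ (q - 1)" using q_pos by (cases q) auto
      also have "\<dots> \<le> x * z" unfolding z_def using x1 by (intro mult_left_mono power_mono) auto
      finally have "D * x ^ q \<le> D * (x * z)" using D_pos by (intro mult_left_mono) auto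
      then show "\<mu> \<le> D * x * z" using \<mu>_le by simp
    qed (use D_pos z0 in auto)
    finally show ?thesis .
  qed
  have "sum ?w (fresh_pairs U) \<le> sum ?w (R1 \<union> R2 \<union> R3)"
    using fin w0 by (intro sum_mono2) (auto simp: R1_def R2_def R3_def)
  also have "\<dots> \<le> sum ?w R1 + sum ?w R2 + sum ?w R3"
    using fin w0 by (intro order.trans[OF sum_Un_le] add_mono) auto
  also have "\<dots> \<le> 2 * (k * D * x * z * \<theta> * (k * D * k * z)) + D * x * z * (k * D * k * z * \<theta>)"
    using S1 S2 S3 by simp
  also have "\<dots> = (2 * k ^ 3 + k ^ 2) * (D\<^sup>2 * x * z\<^sup>2 * \<theta>)"
    by (simp add: power2_eq_square power3_eq_cube algebra_simps)
  also have "\<dots> \<le> (3 * k ^ 3) * (D\<^sup>2 * x * z\<^sup>2 * \<theta>)"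
  proof (rule mult_right_mono)
    have "k ^ 2 \<le> k ^ 3" using k_pos by (intro power_increasing) auto
    then have "2 * k ^ 3 + k ^ 2 \<le> 3 * k ^ 3" by simp
    then show "real (2 * k ^ 3 + k ^ 2) \<le> real (3 * k ^ 3)" by (simp only: of_nat_le_iff)
  qed (use x1 z0 in auto)
  finally show ?thesis by (simp add: z_def \<theta>_def mult_ac)
qed

end

section \<open>Upper tails and seeds\<close>

lemma power_pred_mult: "1 \<le> n \<Longrightarrow> y * y ^ (n - 1) = (y::real) ^ n"
  by (cases n) auto

section \<open>Tail bounds from chains of edges and of intersecting pairs\<close>

context sparse_hypergraph
begin

definition L :: real where "L = 1 - ln p"

lemma L_ge_1: "L \<ge> 1" using p_pos p_le_1 by (simp add: L_def)

lemma markov_upper_tail: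
  assumes "\<epsilon> > 0" "\<mu> > 0"
  shows "measure_pmf.prob (binomial_subset V p) {W. (1 + \<epsilon>) * \<mu> \<le> real (num_edges (induced H W))}
    \<le> 1 / (1 + \<epsilon>)"
proof -
  have "measure_pmf.prob (binomial_subset V p) {W. (1 + \<epsilon>) * \<mu> \<le> real (num_edges (induced H W))}
      \<le> \<mu> / ((1 + \<epsilon>) * \<mu>)"
    unfolding expectation_num_edges[symmetric]
    using assms by (intro markov_binomial_subset finite_V) (auto simp: expectation_num_edges)
  then show ?thesis using assms by simp
qed

text \<open>Every edge is always admissible, so the event itself provides
  \<open>(1 + \<epsilon>) * \<mu>\<close> continuations. With only \<open>\<eta> * x\<close> items,
  the edges meeting \<open>U\<close> add at most \<open>\<epsilon> / 2 * \<mu>\<close> to the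
  weight, without any gain from \<open>p\<close>.\<close>

lemma upper_tail_unrestricted:
  fixes \<eta> :: real
  assumes \<gamma>: "\<gamma> > 0" "\<gamma> * x ^ q \<le> \<mu>" and \<epsilon>: "\<epsilon> > 0" and \<mu>: "\<mu> > 0"
    and \<eta>: "k * \<eta> \<le> 1" "2 * k\<^sup>2 * D * \<eta> \<le> \<epsilon> * \<gamma>" and m: "real m \<le> \<eta> * x"
  shows "measure_pmf.prob (binomial_subset V p) {W. (1 + \<epsilon>) * \<mu> \<le> real (num_edges (induced H W))}
    \<le> ((1 + \<epsilon> / 2) / (1 + \<epsilon>)) ^ m"
proof -
  have "measure_pmf.prob (binomial_subset V p) {W. (1 + \<epsilon>) * \<mu> \<le> real (num_edges (induced H W))}
      \<le> (((1 + \<epsilon> / 2) * \<mu>) / ((1 + \<epsilon>) * \<mu>)) ^ m"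
  proof (rule prob_extendable_le[where R = "\<lambda>_. E" and vs = "\<lambda>f. f" and a = k])
    fix U assume U: "U \<subseteq> V" "card U \<le> k * m"
    have "real (card U) \<le> real k * real m" using U(2) by (simp only: of_nat_le_iff of_nat_mult[symmetric])
    also have "\<dots> \<le> real k * (\<eta> * x)" using m by (intro mult_left_mono) auto
    finally have cU: "real (card U) \<le> k * \<eta> * x" by simp
    have "k * \<eta> * x \<le> 1 * x" using \<eta>(1) x_nonneg by (intro mult_right_mono) auto
    then have "(\<Sum>f\<in>E. p ^ card (f - U)) \<le> \<mu> + k * D * card U * x ^ (q - 1)"
      using cU by (intro weight_edges_le(1) U) auto
    also have "k * D * card U * x ^ (q - 1) \<le> k * D * (k * \<eta> * x) * x ^ (q - 1)"
      using cU D_pos x_nonneg by (intro mult_right_mono mult_left_mono) auto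
    also have "\<dots> = k\<^sup>2 * D * \<eta> * x ^ q"
      using power_pred_mult[OF q_pos, of x, symmetric] by (simp add: power2_eq_square)
    also have "\<dots> \<le> (\<epsilon> * \<gamma> / 2) * x ^ q"
      using \<eta>(2) x_nonneg by (intro mult_right_mono) auto
    also have "\<dots> \<le> \<epsilon> / 2 * \<mu>"
      using mult_left_mono[OF \<gamma>(2), of "\<epsilon> / 2"] \<epsilon> by simp
    finally show "(\<Sum>f\<in>E. p ^ card (f - U)) \<le> (1 + \<epsilon> / 2) * \<mu>" by (simp add: distrib_right)
  qed (use finite_V finite_E edge_subset card_edge p_pos p_le_1 \<epsilon> \<mu>
      in \<open>auto simp: num_edges_induced\<close>)
  then show ?thesis using \<mu> by simp
qed

text \<open>Used with \<open>r = \<epsilon> / 2 * \<mu>\<close> and \<open>s = k * m\<close>, the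
  largest number of vertices that \<open>m\<close> edges can occupy; without a seed, no occupied set
  spans too many edges.\<close>

definition has_seed :: "real \<Rightarrow> nat \<Rightarrow> 'a set \<Rightarrow> bool" where
  "has_seed r s W \<longleftrightarrow> (\<exists>S\<subseteq>W. card S \<le> s \<and> r \<le> card {f \<in> E. f \<subseteq> S})"

text \<open>Only edges with a vertex outside \<open>U\<close> are admissible. Without a seed,
  \<open>U\<close> spans fewer than \<open>\<epsilon> / 2 * \<mu>\<close> edges, so at least
  \<open>(1 + \<epsilon> / 2) * \<mu>\<close> remain. Restricting to them gains
  \<open>p powr (1 / k)\<close>, which by \<open>small\<close> absorbs the powers of
  \<open>L\<close> caused by occupied sets of size up to \<open>k * x * L\<close>.\<close>

lemma upper_tail_no_seed:
  assumes \<gamma>: "\<gamma> > 0" "\<gamma> * x ^ q \<le> \<mu>" and \<epsilon>: "\<epsilon> > 0" and \<mu>: "\<mu> > 0"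
    and small: "4 * k ^ (k + 1) * D * L ^ k * p powr (1 / k) \<le> \<epsilon> * \<gamma>" and m: "real m \<le> x * L"
  shows "measure_pmf.prob (binomial_subset V p)
      {W. (1 + \<epsilon>) * \<mu> \<le> real (num_edges (induced H W)) \<and> \<not> has_seed (\<epsilon> / 2 * \<mu>) (k * m) W}
    \<le> ((1 + \<epsilon> / 4) / (1 + \<epsilon> / 2)) ^ m"
proof -
  define \<theta> where "\<theta> = p powr (1 / k)"
  have \<theta>0: "\<theta> \<ge> 0" by (simp add: \<theta>_def)
  have "measure_pmf.prob (binomial_subset V p)
      {W. (1 + \<epsilon>) * \<mu> \<le> real (num_edges (induced H W)) \<and> \<not> has_seed (\<epsilon> / 2 * \<mu>) (k * m) W}
      \<le> (((1 + \<epsilon> / 4) * \<mu>) / ((1 + \<epsilon> / 2) * \<mu>)) ^ m"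
  proof (rule prob_extendable_le[where R = "\<lambda>U. {f \<in> E. \<not> f \<subseteq> U}" and vs = "\<lambda>f. f" and a = k])
    fix U assume U: "U \<subseteq> V" "card U \<le> k * m"
    define y where "y = k * (x * L)"
    have "real (card U) \<le> real k * real m" using U(2) by (simp only: of_nat_le_iff of_nat_mult[symmetric])
    also have "\<dots> \<le> y" unfolding y_def using m by (intro mult_left_mono) auto
    finally have cU: "real (card U) \<le> y" .
    have kL: "1 \<le> k * L" using k_pos L_ge_1 mult_mono[of 1 "real k" 1 L] by simp
    have xy: "x \<le> y" using mult_right_mono[OF kL x_nonneg] by (simp add: y_def mult_ac)
    have "(\<Sum>f\<in>{f \<in> E. \<not> f \<subseteq> U}. p ^ card (f - U)) \<le> \<mu> + k * D * card U * y ^ (q - 1) * \<theta>"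
      unfolding \<theta>_def using cU xy by (intro weight_edges_le(2) U) auto
    also have "k * D * card U * y ^ (q - 1) * \<theta> \<le> k * D * y * y ^ (q - 1) * \<theta>"
      using cU xy D_pos x_nonneg \<theta>0 by (intro mult_right_mono mult_left_mono) auto
    also have "\<dots> = k * D * y ^ q * \<theta>"
      using power_pred_mult[OF q_pos, of y, symmetric] by simp
    also have "\<dots> = k * D * (k * L) ^ q * x ^ q * \<theta>"
      by (simp add: y_def power_mult_distrib)
    \<comment> \<open>Replacing the exponent \<open>q\<close> by \<open>k\<close> makes the
      smallness condition independent of \<open>q\<close>, as the constant of the theorem must
      be.\<close>
    also have "\<dots> \<le> k * D * (k * L) ^ k * x ^ q * \<theta>"
      using kL q_less D_pos x_nonneg \<theta>0
      by (intro mult_right_mono mult_left_mono power_increasing) auto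
    also have "\<dots> = k ^ (k + 1) * D * L ^ k * \<theta> * x ^ q"
      by (simp add: power_mult_distrib)
    also have "\<dots> \<le> (\<epsilon> * \<gamma> / 4) * x ^ q"
      using small x_nonneg by (intro mult_right_mono) (auto simp: \<theta>_def)
    also have "\<dots> \<le> \<epsilon> / 4 * \<mu>"
      using mult_left_mono[OF \<gamma>(2), of "\<epsilon> / 4"] \<epsilon> by simp
    finally show "(\<Sum>f\<in>{f \<in> E. \<not> f \<subseteq> U}. p ^ card (f - U)) \<le> (1 + \<epsilon> / 4) * \<mu>"
      by (simp add: distrib_right)
  next
    fix W U assume W: "W \<subseteq> V" "W \<in> {W. (1 + \<epsilon>) * \<mu> \<le> real (num_edges (induced H W)) \<and>
      \<not> has_seed (\<epsilon> / 2 * \<mu>) (k * m) W}" and U: "U \<subseteq> W" "card U \<le> k * m"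
    have "card {f \<in> E. f \<subseteq> W} \<le> card ({f \<in> {f \<in> E. \<not> f \<subseteq> U}. f \<subseteq> W} \<union> {f \<in> E. f \<subseteq> U})"
      using finite_E by (intro card_mono) auto
    also have "\<dots> \<le> card {f \<in> {f \<in> E. \<not> f \<subseteq> U}. f \<subseteq> W} + card {f \<in> E. f \<subseteq> U}"
      by (rule card_Un_le)
    finally have "(1 + \<epsilon>) * \<mu> \<le> card {f \<in> {f \<in> E. \<not> f \<subseteq> U}. f \<subseteq> W} + card {f \<in> E. f \<subseteq> U}"
      using W by (simp add: num_edges_induced)
    moreover have "card {f \<in> E. f \<subseteq> U} < \<epsilon> / 2 * \<mu>"
      using W U by (auto simp: has_seed_def not_le)
    ultimately show "(1 + \<epsilon> / 2) * \<mu> \<le> card {f \<in> {f \<in> E. \<not> f \<subseteq> U}. f \<subseteq> W}"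
      by (simp add: algebra_simps)
  qed (use finite_V finite_E edge_subset card_edge p_pos p_le_1 \<epsilon> \<mu> in auto)
  then show ?thesis using \<mu> by simp
qed

text \<open>Chains of \<open>t\<close> fresh pairs. The conditions on \<open>t\<close> ensure that
  the occupied set has at most \<open>x\<close> vertices and spans at most half of the edges of the
  seed; the intersecting pairs among the other edges give \<open>lam\<close>, while their expected
  weight \<Lambda> carries the factor \<open>p powr (1 / k)\<close>.\<close>

lemma prob_seed_le:
  assumes \<gamma>: "\<gamma> > 0" "\<gamma> * x ^ q \<le> \<mu>" and \<epsilon>: "\<epsilon> > 0" and \<mu>: "\<mu> > 0"
    and x: "k \<le> x" and m: "real m \<le> x * L" "real m \<le> \<epsilon> / 8 * \<mu>"
    and t: "2 * k * real t \<le> x" "D * (2 * k * real t) ^ q \<le> \<epsilon> / 4 * \<mu>"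
  shows "measure_pmf.prob (binomial_subset V p) {W. has_seed (\<epsilon> / 2 * \<mu>) (k * m) W}
    \<le> (96 * k ^ 3 * D\<^sup>2 * 4 ^ k / (\<epsilon> * \<gamma>)\<^sup>2 * L * p powr (1 / k)) ^ t"
proof -
  define \<theta> where "\<theta> = p powr (1 / k)"
  define z where "z = x * (x ^ (q - 1))\<^sup>2"
  have x0: "x > 0" using x k_pos by linarith
  have z0: "z > 0" using x0 by (simp add: z_def)
  have \<theta>0: "\<theta> > 0" using p_pos by (simp add: \<theta>_def)
  define \<Lambda> where "\<Lambda> = 3 * k ^ 3 * D\<^sup>2 * 4 ^ k * z * \<theta>"
  \<comment> \<open>This is \<open>(card J)\<^sup>2 / (2 * m)\<close> with \<open>card J\<close>
    replaced by its lower bound \<open>\<epsilon> / 4 * \<gamma> * x ^ q\<close> and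
    \<open>m\<close> by its upper bound \<open>x * L\<close>.\<close>
  define lam where "lam = (\<epsilon> * \<gamma>)\<^sup>2 * z / (32 * L)"
  have lam0: "lam > 0" using \<epsilon> \<gamma> z0 L_ge_1 by (simp add: lam_def)
  have "measure_pmf.prob (binomial_subset V p) {W. has_seed (\<epsilon> / 2 * \<mu>) (k * m) W} \<le> (\<Lambda> / lam) ^ t"
  proof (rule prob_extendable_le[where R = fresh_pairs and vs = "\<lambda>(f, g). f \<union> g" and a = "2 * k"])
    fix U e assume "e \<in> fresh_pairs U"
    then have e: "fst e \<in> E" "snd e \<in> E" by (auto simp: fresh_pairs_def)
    have "card (fst e \<union> snd e) \<le> 2 * k"
      using card_Un_le[of "fst e" "snd e"] e by (simp add: card_edge)
    then show "(case e of (f, g) \<Rightarrow> f \<union> g) \<subseteq> V \<and> card (case e of (f, g) \<Rightarrow> f \<union> g) \<le> 2 * k"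
      using edge_subset[OF e(1)] edge_subset[OF e(2)] by (simp add: case_prod_beta)
  next
    fix U assume U: "U \<subseteq> V" "card U \<le> 2 * k * t"
    have "real (card U) \<le> real (2 * k * t)" using U(2) by (simp only: of_nat_le_iff)
    then have "real (card U) \<le> x" using t(1) by simp
    then have "(\<Sum>(f, g)\<in>fresh_pairs U. p ^ card (f \<union> g - U))
        \<le> 3 * k ^ 3 * D\<^sup>2 * x * ((2 * x) ^ (q - 1))\<^sup>2 * \<theta>"
      unfolding \<theta>_def using U x by (intro weight_fresh_pairs_le) auto
    also have "((2 * x) ^ (q - 1))\<^sup>2 = 4 ^ (q - 1) * (x ^ (q - 1))\<^sup>2"
      using power_mult_distrib[of "2::real" 2 "q - 1"]
      by (simp add: power_mult_distrib power2_eq_square)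
    also have "3 * k ^ 3 * D\<^sup>2 * x * (4 ^ (q - 1) * (x ^ (q - 1))\<^sup>2) * \<theta> =
        3 * k ^ 3 * D\<^sup>2 * 4 ^ (q - 1) * z * \<theta>" by (simp add: z_def)
    also have "\<dots> \<le> \<Lambda>"
      unfolding \<Lambda>_def using q_less z0 \<theta>0
      by (intro mult_right_mono mult_left_mono power_increasing) auto
    finally show "(\<Sum>e\<in>fresh_pairs U. p ^ card ((case e of (f, g) \<Rightarrow> f \<union> g) - U)) \<le> \<Lambda>"
      by (simp add: case_prod_beta)
  next
    fix W U
    assume W: "W \<subseteq> V" "W \<in> {W. has_seed (\<epsilon> / 2 * \<mu>) (k * m) W}"
      and U: "U \<subseteq> W" "card U \<le> 2 * k * t"
    then obtain S where S: "S \<subseteq> W" "card S \<le> k * m" "\<epsilon> / 2 * \<mu> \<le> card {f \<in> E. f \<subseteq> S}"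
      by (auto simp: has_seed_def)
    have fin: "finite S" "finite U" "finite W" using S U W finite_V by (auto intro: finite_subset)
    \<comment> \<open>The edges of the seed that are still usable; at least
      \<open>\<epsilon> / 4 * \<mu>\<close> of them remain after removing those inside
      \<open>U\<close>.\<close>
    define J where "J = {f \<in> E. f \<subseteq> S \<and> \<not> f \<subseteq> U}"
    have "real (card U) \<le> real (2 * k * t)" using U(2) by (simp only: of_nat_le_iff)
    then have cU: "real (card U) \<le> 2 * k * real t" by simp
    have "real (card {f \<in> E. f \<subseteq> U}) \<le> D * real (card U) ^ q"
      by (rule card_edges_inside_le[OF fin(2)])
    also have "\<dots> \<le> D * (2 * k * real t) ^ q"
      using D_pos cU by (intro mult_left_mono power_mono) auto
    finally have eU: "real (card {f \<in> E. f \<subseteq> U}) \<le> \<epsilon> / 4 * \<mu>" using t(2) by simp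
    have "card {f \<in> E. f \<subseteq> S} \<le> card (J \<union> {f \<in> E. f \<subseteq> U})"
      using finite_E by (intro card_mono) (auto simp: J_def)
    also have "\<dots> \<le> card J + card {f \<in> E. f \<subseteq> U}" by (rule card_Un_le)
    finally have "real (card {f \<in> E. f \<subseteq> S}) \<le> card J + card {f \<in> E. f \<subseteq> U}" by simp
    then have J: "\<epsilon> / 4 * \<mu> \<le> card J" using S(3) eU by (simp add: field_simps)
    then have J0: "J \<noteq> {}" using mult_pos_pos[OF \<epsilon> \<mu>] by auto
    \<comment> \<open>Needed to compare the fractions below, since division by \<open>m = 0\<close>
      would yield 0. An empty seed cannot contain an edge.\<close>
    have m0: "m > 0"
    proof (rule ccontr)
      assume "\<not> m > 0"
      then have "S = {}" using S(2) fin by simp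
      moreover obtain f where "f \<in> J" using J0 by blast
      ultimately show False using card_edge[of f] k_pos by (auto simp: J_def)
    qed
    have "lam = (\<epsilon> / 4 * (\<gamma> * x ^ q))\<^sup>2 / (2 * (x * L))"
      using x0 L_ge_1 power_pred_mult[OF q_pos, of x, symmetric]
      by (simp add: lam_def z_def power2_eq_square field_simps)
    also have "\<dots> \<le> (real (card J))\<^sup>2 / (2 * m)"
    proof (intro frac_le power_mono)
      have "\<epsilon> / 4 * (\<gamma> * x ^ q) \<le> \<epsilon> / 4 * \<mu>" using \<epsilon> \<gamma> by (intro mult_left_mono) auto
      then show "\<epsilon> / 4 * (\<gamma> * x ^ q) \<le> card J" using J by linarith
    qed (use m m0 \<epsilon> \<gamma> x0 in auto)
    also have "\<dots> \<le> card {(f, g) \<in> J \<times> J. f \<noteq> g \<and> f \<inter> g \<noteq> {}}"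
    proof (rule distinct_intersecting_pairs_ge[OF fin(1) _ k_pos S(2) _ J0])
      show "2 * real m \<le> card J" using m(2) J by linarith
    qed (use card_edge in \<open>auto simp: J_def\<close>)
    also have "\<dots> \<le> card {e \<in> fresh_pairs U. (case e of (f, g) \<Rightarrow> f \<union> g) \<subseteq> W}"
      using finite_fresh_pairs[of U] S(1)
      by (intro of_nat_mono card_mono) (auto simp: J_def fresh_pairs_def)
    finally show "lam \<le> card {e \<in> fresh_pairs U. (case e of (f, g) \<Rightarrow> f \<union> g) \<subseteq> W}" .
  qed (use finite_V finite_fresh_pairs p_pos p_le_1 lam0 in auto)
  also have "\<Lambda> / lam = 96 * k ^ 3 * D\<^sup>2 * 4 ^ k / (\<epsilon> * \<gamma>)\<^sup>2 * L * \<theta>"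
    using z0 L_ge_1 \<epsilon> \<gamma> by (simp add: \<Lambda>_def lam_def field_simps)
  finally show ?thesis unfolding \<theta>_def .
qed

end

section \<open>Choice of the lengths\<close>

lemma log_power_powr_le_1_near_0:
  fixes A e :: real
  assumes "e > 0"
  shows "eventually (\<lambda>p. A * (1 - ln p) ^ n * p powr e \<le> 1) (at_right 0)"
proof -
  have "((\<lambda>p. A * (1 - ln p) ^ n * p powr e) \<longlongrightarrow> 0) (at_right 0)"
    using assms by real_asymp
  then show ?thesis
    by (auto dest!: order_tendstoD(2)[where a = 1] elim: eventually_mono)
qed

text \<open>Rounding loses at most 1, hence at most half of \<open>r\<close>. This is why the real
  lengths below are first shown to be at least 2.\<close>

lemma nat_floor_bounds:
  fixes r :: real
  assumes "r \<ge> 2"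
  shows "real (nat \<lfloor>r\<rfloor>) \<le> r" "r / 2 \<le> real (nat \<lfloor>r\<rfloor>)"
  using assms by linarith+

lemma ratio_power_eq_exp:
  fixes u v :: real
  assumes "0 < u" "0 < v"
  shows "(u / v) ^ m = exp (- (ln (v / u) * m))"
proof -
  have "u / v = exp (- ln (v / u))" using assms by (simp add: exp_minus)
  then have "(u / v) ^ m = exp (- ln (v / u)) ^ m" by (rule arg_cong)
  also have "\<dots> = exp (real m * - ln (v / u))" by (rule exp_of_nat_mult[symmetric])
  finally show ?thesis by (simp add: mult.commute)
qed

section \<open>The target exponent and the two ranges of \<open>p\<close>\<close>

context sparse_hypergraph
begin

definition G :: real where "G = min \<mu> (\<mu> powr (1 / q) * L)"

text \<open>Take \<open>q\<close>-th roots in \<open>\<mu> \<le> D * x ^ q\<close>; the assumption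
  \<open>D \<ge> 1\<close> allows \<open>D powr (1 / q)\<close> to be replaced by \<open>D\<close>,
  free of \<open>q\<close>.\<close>

lemma G_le:
  assumes "\<mu> > 0" "D \<ge> 1"
  shows "G \<le> D * x * L"
proof -
  have "x \<noteq> 0" using \<mu>_le assms q_pos by (auto simp: power_0_left)
  then have x0: "x > 0" using x_nonneg by simp
  have xq: "(x ^ q) powr (1 / q) = x"
    using x0 q_pos by (simp add: powr_realpow[symmetric] powr_powr)
  have "\<mu> powr (1 / q) \<le> (D * x ^ q) powr (1 / q)"
    using \<mu>_le assms by (intro powr_mono2) auto
  also have "\<dots> = D powr (1 / q) * x"
    using D_pos x0 xq by (simp add: powr_mult)
  also have "\<dots> \<le> D powr 1 * x"
    using assms x0 q_pos by (intro mult_right_mono powr_mono) auto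
  finally have "\<mu> powr (1 / q) * L \<le> D * x * L"
    using D_pos L_ge_1 by (intro mult_right_mono) auto
  then show ?thesis unfolding G_def by linarith
qed

text \<open>Here \<open>L\<close> is at most the constant \<open>1 - ln p0\<close>, so
  \<open>G\<close> is at most a constant times \<open>x\<close>, and about \<open>\<eta> * x\<close>
  unrestricted edges give the right exponent.\<close>

lemma upper_tail_large_p:
  fixes \<eta> :: real
  assumes \<gamma>: "\<gamma> > 0" "\<gamma> * x ^ q \<le> \<mu>" and \<epsilon>: "\<epsilon> > 0" and \<mu>: "\<mu> > 0" and D: "D \<ge> 1"
    and \<eta>: "\<eta> > 0" "k * \<eta> \<le> 1" "2 * k\<^sup>2 * D * \<eta> \<le> \<epsilon> * \<gamma>"
    and p0: "0 < p0" "p0 \<le> p" and G: "2 * D * (1 - ln p0) / \<eta> \<le> G"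
  shows "measure_pmf.prob (binomial_subset V p) {W. (1 + \<epsilon>) * \<mu> \<le> real (num_edges (induced H W))}
    \<le> exp (- (ln ((1 + \<epsilon>) / (1 + \<epsilon> / 2)) * \<eta> / (2 * D * (1 - ln p0)) * G))"
proof -
  define L0 where "L0 = 1 - ln p0"
  define a where "a = ln ((1 + \<epsilon>) / (1 + \<epsilon> / 2))"
  have a0: "a > 0" using \<epsilon> by (auto simp: a_def)
  have LL0: "L \<le> L0" using p0 by (auto simp: L_def L0_def)
  then have L0: "L0 \<ge> 1" using L_ge_1 by simp
  have "G \<le> D * x * L" by (rule G_le[OF \<mu> D])
  also have "\<dots> \<le> D * x * L0" using LL0 D x_nonneg by (intro mult_left_mono) auto
  finally have Gx: "G \<le> D * x * L0" .
  \<comment> \<open>Comparing both bounds on \<open>G\<close> yields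
    \<open>\<eta> * x \<ge> 2\<close>, as required for rounding.\<close>
  have "2 * D * L0 / \<eta> \<le> D * x * L0" using Gx G by (simp add: L0_def)
  then have \<eta>x: "2 \<le> \<eta> * x" using D L0 \<eta>(1) by (simp add: field_simps)
  define m where "m = nat \<lfloor>\<eta> * x\<rfloor>"
  have m: "real m \<le> \<eta> * x" "\<eta> * x / 2 \<le> real m"
    unfolding m_def using nat_floor_bounds[OF \<eta>x] by auto
  have "\<eta> / (2 * D * L0) * G \<le> \<eta> / (2 * D * L0) * (D * x * L0)"
    using Gx \<eta> D L0 by (intro mult_left_mono) auto
  also have "\<dots> = \<eta> * x / 2" using D L0 by simp
  finally have "\<eta> / (2 * D * L0) * G \<le> real m" using m by simp
  then have "a * (\<eta> / (2 * D * L0) * G) \<le> a * real m" using a0 by (intro mult_left_mono) auto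
  then have *: "exp (- (a * real m)) \<le> exp (- (a * \<eta> / (2 * D * L0) * G))" by simp
  have "measure_pmf.prob (binomial_subset V p) {W. (1 + \<epsilon>) * \<mu> \<le> real (num_edges (induced H W))}
      \<le> ((1 + \<epsilon> / 2) / (1 + \<epsilon>)) ^ m"
    by (rule upper_tail_unrestricted[OF \<gamma> \<epsilon> \<mu> \<eta>(2,3) m(1)])
  also have "\<dots> = exp (- (a * real m))"
    unfolding a_def using \<epsilon> by (intro ratio_power_eq_exp) auto
  also note *
  finally show ?thesis unfolding a_def L0_def .
qed

text \<open>Splits the event according to whether a seed exists, with \<open>m\<close> about
  \<open>\<kappa> * G\<close> and \<open>t\<close> about \<open>c\<^sub>1 * x\<close>. The two upper
  bounds on \<kappa> give \<open>m \<le> x * L\<close> and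
  \<open>m \<le> \<epsilon> / 8 * \<mu>\<close>; those on \<open>c\<^sub>1\<close> give the two
  conditions on \<open>t\<close>.\<close>

lemma upper_tail_small_p:
  fixes \<kappa> c\<^sub>1 :: real
  assumes \<gamma>: "\<gamma> > 0" "\<gamma> * x ^ q \<le> \<mu>" and \<epsilon>: "\<epsilon> > 0" and \<mu>: "\<mu> > 0" and D: "D \<ge> 1"
    and small: "4 * k ^ (k + 1) * D * L ^ k * p powr (1 / k) \<le> \<epsilon> * \<gamma>"
      "96 * k ^ 3 * D\<^sup>2 * 4 ^ k / (\<epsilon> * \<gamma>)\<^sup>2 * L * p powr (1 / k) \<le> p powr (1 / (2 * k))"
      "p \<le> exp (- 1)"
    and \<kappa>: "\<kappa> > 0" "\<kappa> \<le> 1 / D" "\<kappa> \<le> \<epsilon> / 8"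
    and c\<^sub>1: "c\<^sub>1 > 0" "2 * k * c\<^sub>1 \<le> 1" "D * (2 * k * c\<^sub>1) \<le> \<epsilon> / 4 * \<gamma>"
    and G: "2 / \<kappa> \<le> G" and x: "k \<le> x" "2 / c\<^sub>1 \<le> x"
  shows "measure_pmf.prob (binomial_subset V p) {W. (1 + \<epsilon>) * \<mu> \<le> real (num_edges (induced H W))}
    \<le> exp (- (ln ((1 + \<epsilon> / 2) / (1 + \<epsilon> / 4)) * \<kappa> / 2 * G)) + exp (- (c\<^sub>1 / (8 * k * D) * G))"
proof -
  define b where "b = ln ((1 + \<epsilon> / 2) / (1 + \<epsilon> / 4))"
  have b0: "b > 0" using \<epsilon> by (auto simp: b_def)
  have x0: "x > 0" using x k_pos by linarith
  have \<kappa>G: "2 \<le> \<kappa> * G" and c\<^sub>1x: "2 \<le> c\<^sub>1 * x" using G \<kappa> c\<^sub>1 x by (auto simp: field_simps)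
  have G0: "G > 0" using \<kappa>G \<kappa> by (metis less_le_trans zero_less_mult_pos zero_less_numeral)
  define m where "m = nat \<lfloor>\<kappa> * G\<rfloor>"
  define t where "t = nat \<lfloor>c\<^sub>1 * x\<rfloor>"
  have m: "real m \<le> \<kappa> * G" "\<kappa> * G / 2 \<le> real m"
    unfolding m_def using nat_floor_bounds[OF \<kappa>G] by auto
  have t: "real t \<le> c\<^sub>1 * x" "c\<^sub>1 * x / 2 \<le> real t"
    unfolding t_def using nat_floor_bounds[OF c\<^sub>1x] by auto
  have Gx: "G \<le> D * x * L" by (rule G_le[OF \<mu> D])
  have "\<kappa> * G \<le> 1 / D * (D * x * L)" using \<kappa> Gx G0 D by (intro mult_mono) auto
  then have mx: "real m \<le> x * L" using m D by simp
  have "\<kappa> * G \<le> \<epsilon> / 8 * \<mu>" using \<kappa> G0 \<epsilon> by (intro mult_mono) (auto simp: G_def)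
  then have m\<mu>: "real m \<le> \<epsilon> / 8 * \<mu>" using m by simp
  have kt: "2 * k * real t \<le> 2 * k * c\<^sub>1 * x" using t(1) mult_left_mono[of "real t" _ "2 * k"] by simp
  also have "\<dots> \<le> 1 * x" using c\<^sub>1 x0 by (intro mult_right_mono) auto
  finally have tx: "2 * k * real t \<le> x" by simp
  have "D * (2 * k * real t) ^ q \<le> D * (2 * k * c\<^sub>1 * x) ^ q"
    using kt D by (intro mult_left_mono power_mono) auto
  also have "\<dots> = D * (2 * k * c\<^sub>1) ^ q * x ^ q" by (simp add: power_mult_distrib)
  \<comment> \<open>The base is at most 1 and \<open>q \<ge> 1\<close>, so the condition on
    \<open>c\<^sub>1\<close> need not involve \<open>q\<close>.\<close>
  also have "\<dots> \<le> D * (2 * k * c\<^sub>1) ^ 1 * x ^ q"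
    using c\<^sub>1 q_pos D x0 by (intro mult_right_mono mult_left_mono power_decreasing) auto
  also have "\<dots> \<le> (\<epsilon> / 4 * \<gamma>) * x ^ q" using c\<^sub>1 x0 by (intro mult_right_mono) auto
  also have "\<dots> \<le> \<epsilon> / 4 * \<mu>" using mult_left_mono[OF \<gamma>(2), of "\<epsilon> / 4"] \<epsilon> by simp
  finally have tq: "D * (2 * k * real t) ^ q \<le> \<epsilon> / 4 * \<mu>" .

  let ?X = "\<lambda>W. real (num_edges (induced H W))"
  let ?seed = "has_seed (\<epsilon> / 2 * \<mu>) (k * m)"
  let ?P = "measure_pmf.prob (binomial_subset V p)"
  have "?P {W. (1 + \<epsilon>) * \<mu> \<le> ?X W} \<le> ?P ({W. (1 + \<epsilon>) * \<mu> \<le> ?X W \<and> \<not> ?seed W} \<union> {W. ?seed W})"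
    by (intro measure_pmf.finite_measure_mono) auto
  also have "\<dots> \<le> ?P {W. (1 + \<epsilon>) * \<mu> \<le> ?X W \<and> \<not> ?seed W} + ?P {W. ?seed W}"
    by (intro measure_subadditive) (auto simp: measure_pmf.emeasure_eq_measure)
  also have "?P {W. (1 + \<epsilon>) * \<mu> \<le> ?X W \<and> \<not> ?seed W} \<le> exp (- (b * \<kappa> / 2 * G))"
  proof -
    have "?P {W. (1 + \<epsilon>) * \<mu> \<le> ?X W \<and> \<not> ?seed W} \<le> ((1 + \<epsilon> / 4) / (1 + \<epsilon> / 2)) ^ m"
      by (rule upper_tail_no_seed[OF \<gamma> \<epsilon> \<mu> small(1) mx])
    also have "\<dots> = exp (- (b * m))"
      unfolding b_def using \<epsilon> by (intro ratio_power_eq_exp) auto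
    also have "\<dots> \<le> exp (- (b * \<kappa> / 2 * G))"
      using mult_left_mono[OF m(2), of b] b0 by simp
    finally show ?thesis .
  qed
  also have "?P {W. ?seed W} \<le> exp (- (c\<^sub>1 / (8 * k * D) * G))"
  proof -
    define \<theta> where "\<theta> = 96 * k ^ 3 * D\<^sup>2 * 4 ^ k / (\<epsilon> * \<gamma>)\<^sup>2 * L * p powr (1 / k)"
    have "\<theta> \<ge> 0" using L_ge_1 by (simp add: \<theta>_def)
    have "?P {W. ?seed W} \<le> \<theta> ^ t"
      unfolding \<theta>_def by (rule prob_seed_le[OF \<gamma> \<epsilon> \<mu> x(1) mx m\<mu> tx tq])
    \<comment> \<open>Half of the exponent \<open>1 / k\<close> absorbs \<open>L\<close> and the
      constants; the other half provides the decay.\<close>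
    also have "\<dots> \<le> (p powr (1 / (2 * k))) ^ t"
      using small(2) \<open>\<theta> \<ge> 0\<close> unfolding \<theta>_def by (intro power_mono)
    also have "\<dots> = exp (- (real t / (2 * k) * - ln p))"
      using p_pos by (simp add: powr_def exp_of_nat_mult[symmetric] mult_ac)
    also have "\<dots> \<le> exp (- (c\<^sub>1 / (8 * k * D) * G))"
    proof -
      have "ln p \<le> - 1" using small(3) p_pos ln_le_cancel_iff[of p "exp (- 1)"] by simp
      then have lnp: "L / 2 \<le> - ln p" by (simp add: L_def)
      have "c\<^sub>1 / (8 * k * D) * G \<le> c\<^sub>1 / (8 * k * D) * (D * x * L)"
        using Gx c\<^sub>1 D by (intro mult_left_mono) auto
      \<comment> \<open>The 8 collects three halvings: rounding of \<open>t\<close>, the exponent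
        \<open>1 / (2 * k)\<close>, and \<open>L / 2 \<le> - ln p\<close>.\<close>
      also have "\<dots> = c\<^sub>1 * x / 2 / (2 * k) * (L / 2)" using D by simp
      also have "\<dots> \<le> real t / (2 * k) * - ln p"
        using t c\<^sub>1 x0 lnp L_ge_1 by (intro mult_mono divide_right_mono) auto
      finally show ?thesis by simp
    qed
    finally show ?thesis .
  qed
  finally show ?thesis unfolding b_def by simp
qed

end

section \<open>Choice of constants and case distinction\<close>

theorem theorem1:
  fixes k :: nat and \<gamma> D \<epsilon> :: real
  assumes "\<gamma> > 0" and "D > 0" and "\<epsilon> > 0"
  shows "\<exists>c::real. c > 0 \<and>
    (\<forall>(q::nat) (N::real) (H :: 'a hypergraph) (p::real).
       1 \<le> q \<and> q < k \<and>
       finite_hypergraph H \<and> uniform k H \<and>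
       real (num_verts H) \<le> N \<and>
       real (num_edges H) \<ge> \<gamma> * N ^ q \<and>
       real (max_degree q H) \<le> D \<and>
       0 < p \<and> p \<le> 1 \<longrightarrow>
       (let Vp = binomial_subset (verts H) p;
            X = (\<lambda>W. real (num_edges (induced H W)));
            \<mu> = measure_pmf.expectation Vp X
        in measure_pmf.prob Vp {W. X W \<ge> (1 + \<epsilon>) * \<mu>}
             \<le> exp (- c * min \<mu> (\<mu> powr (1 / real q) * ln (exp 1 / p)))))"
proof (cases "k = 0")
  case True
  then show ?thesis by (intro exI[of _ 1]) auto
next
  case False
  then have k0: "real k > 0" by simp
  \<comment> \<open>Enlarging \<open>D\<close> to at least 1 preserves the degree bound and meets
    the requirement of \<open>G_le\<close>.\<close>
  define D' where "D' = max 1 D"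
  have D': "D' \<ge> 1" "D \<le> D'" by (auto simp: D'_def)
  define K where "K = 96 * k ^ 3 * D'\<^sup>2 * 4 ^ k / (\<epsilon> * \<gamma>)\<^sup>2"
  have "eventually (\<lambda>p. 4 * k ^ (k + 1) * D' / (\<epsilon> * \<gamma>) * (1 - ln p) ^ k * p powr (1 / k) \<le> 1
      \<and> K * (1 - ln p) ^ 1 * p powr (1 / (2 * k)) \<le> 1) (at_right 0)"
    using k0 by (intro eventually_conj log_power_powr_le_1_near_0) auto
  then obtain p1 where p1: "p1 > 0" "\<And>p. 0 < p \<Longrightarrow> p < p1 \<Longrightarrow>
      4 * k ^ (k + 1) * D' / (\<epsilon> * \<gamma>) * (1 - ln p) ^ k * p powr (1 / k) \<le> 1 \<and>
      K * (1 - ln p) ^ 1 * p powr (1 / (2 * k)) \<le> 1"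
    unfolding eventually_at_right_field by blast
  \<comment> \<open>Below \<open>p1\<close> powers of \<open>p\<close> beat the logarithms;
    \<open>p \<le> exp (- 1)\<close> gives \<open>L / 2 \<le> - ln p\<close>.\<close>
  define p0 where "p0 = min p1 (exp (- 1))"
  have p0: "p0 > 0" "p0 \<le> exp (- 1)" using p1 by (auto simp: p0_def)
  have "ln p0 \<le> - 1" using p0 ln_le_cancel_iff[of p0 "exp (- 1)"] by simp
  then have L0: "1 - ln p0 > 0" by simp
  define \<eta> where "\<eta> = min (1 / k) (\<epsilon> * \<gamma> / (2 * k\<^sup>2 * D'))"
  define \<kappa> where "\<kappa> = min (1 / D') (\<epsilon> / 8)"
  define c\<^sub>1 where "c\<^sub>1 = min (1 / (2 * k)) (\<epsilon> * \<gamma> / (8 * k * D'))"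
  \<comment> \<open>The lower bound for \<open>x\<close> needed when \<open>p\<close> is
    small.\<close>
  define B where "B = max (real k) (max (2 / c\<^sub>1) 1)"
  define e1 where "e1 = ln ((1 + \<epsilon>) / (1 + \<epsilon> / 2)) * \<eta> / (2 * D' * (1 - ln p0))"
  define e2 where "e2 = min (ln ((1 + \<epsilon> / 2) / (1 + \<epsilon> / 4)) * \<kappa> / 2) (c\<^sub>1 / (8 * k * D'))"
  \<comment> \<open>Beyond this threshold for \<open>G\<close>, the lengths exceed 2, the entry
    \<open>D' * B ^ k\<close> forces \<open>x > B\<close> when \<open>p < p0\<close>, and the last
    entry absorbs the factor 2 from adding two exponentials.\<close>
  define C where "C = max (2 * D' * (1 - ln p0) / \<eta>) (max (2 / \<kappa>) (max (D' * B ^ k) (2 * ln 2 / e2)))"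
  \<comment> \<open>One entry for each case: bounded \<open>G\<close>, large \<open>p\<close>, small
    \<open>p\<close>. None depends on \<open>q\<close>, \<open>N\<close>, \<open>H\<close> or
    \<open>p\<close>.\<close>
  define c where "c = min (ln (1 + \<epsilon>) / C) (min e1 (e2 / 2))"
  have \<eta>: "\<eta> > 0" "k * \<eta> \<le> 1" "2 * k\<^sup>2 * D' * \<eta> \<le> \<epsilon> * \<gamma>"
    using k0 D' assms by (auto simp: \<eta>_def min_def field_simps)
  have \<kappa>: "\<kappa> > 0" "\<kappa> \<le> 1 / D'" "\<kappa> \<le> \<epsilon> / 8" using D' assms by (auto simp: \<kappa>_def)
  have c\<^sub>1: "c\<^sub>1 > 0" "2 * k * c\<^sub>1 \<le> 1" "D' * (2 * k * c\<^sub>1) \<le> \<epsilon> / 4 * \<gamma>"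
    using k0 D' assms by (auto simp: c\<^sub>1_def min_def field_simps)
  have e1: "e1 > 0" unfolding e1_def using \<eta> D' L0 assms by (intro divide_pos_pos mult_pos_pos) auto
  have e2: "e2 > 0" unfolding e2_def using \<kappa> c\<^sub>1 k0 D' assms
    by (intro min_less_iff_conj[THEN iffD2] conjI divide_pos_pos mult_pos_pos) auto
  have B: "B \<ge> 1" "B \<ge> k" "B \<ge> 2 / c\<^sub>1" by (auto simp: B_def)
  have C: "2 * D' * (1 - ln p0) / \<eta> \<le> C" "2 / \<kappa> \<le> C" "D' * B ^ k \<le> C" "2 * ln 2 / e2 \<le> C"
    by (auto simp: C_def)
  have C0: "C > 0" using C(2) \<kappa>(1) by (meson divide_pos_pos less_le_trans zero_less_numeral)
  have "c > 0" using C0 e1 e2 assms by (auto simp: c_def)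
  moreover have "c \<le> ln (1 + \<epsilon>) / C" "c \<le> e1" "c \<le> e2 / 2"
    unfolding c_def by linarith+
  ultimately have c: "c > 0" "c \<le> ln (1 + \<epsilon>) / C" "c \<le> e1" "c \<le> e2 / 2" .
  show ?thesis
  proof (intro exI[of _ c] conjI c(1) allI impI, elim conjE)
    fix q :: nat and N :: real and H :: "'a hypergraph" and p :: real
    assume H: "1 \<le> q" "q < k" "finite_hypergraph H" "uniform k H" "real (num_verts H) \<le> N"
      "\<gamma> * N ^ q \<le> real (num_edges H)" "real (max_degree q H) \<le> D" "0 < p" "p \<le> 1"
    interpret sparse_hypergraph H k q N D' p
      using H D' by unfold_locales auto
    let ?prob = "measure_pmf.prob (binomial_subset V p)
      {W. (1 + \<epsilon>) * \<mu> \<le> real (num_edges (induced H W))}"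
    have \<gamma>\<mu>: "\<gamma> * x ^ q \<le> \<mu>"
      using mult_right_mono[OF H(6), of "p ^ k"] H(8) by (simp add: x_power \<mu>_def num_edges_def)
    have main: "?prob \<le> exp (- c * G)"
    proof (cases "G \<le> 0")
      case True
      \<comment> \<open>The claimed bound is then at least 1.\<close>
      then have "0 \<le> - c * G" using c by (simp add: mult_nonneg_nonpos)
      then have "1 \<le> exp (- c * G)" by simp
      then show ?thesis using measure_pmf.prob_le_1 by (rule order.trans[rotated])
    next
      case False
      then have G0: "G > 0" by simp
      then have \<mu>: "\<mu> > 0" by (simp add: G_def)
      show ?thesis
      proof (cases "G \<le> C")
        case True
        \<comment> \<open>For bounded \<open>G\<close> the claimed bound is no smaller than
          \<open>1 / (1 + \<epsilon>)\<close>, which is what Markov's inequality for the edge count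
          gives.\<close>
        have "c * G \<le> ln (1 + \<epsilon>) / C * C"
          using c True G0 C0 assms by (intro mult_mono) auto
        then have "exp (- ln (1 + \<epsilon>)) \<le> exp (- c * G)" using C0
          by (simp only: exp_le_cancel_iff) simp
        then show ?thesis
          using markov_upper_tail[OF assms(3) \<mu>]
          unfolding exp_minus inverse_eq_divide exp_ln[OF add_pos_pos[OF zero_less_one assms(3)]]
          by linarith
      next
        case large: False
        show ?thesis
        proof (cases "p0 \<le> p")
          case True
          have "?prob \<le> exp (- (e1 * G))"
            unfolding e1_def using large C
            by (intro upper_tail_large_p[OF assms(1) \<gamma>\<mu> assms(3) \<mu> D'(1) \<eta> p0(1) True]) auto
          also have "\<dots> \<le> exp (- c * G)" using c(3) G0 by simp
          finally show ?thesis .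
        next
          case False
          then have pp: "p < p1" "p \<le> exp (- 1)" by (auto simp: p0_def)
          note small = p1(2)[OF H(8) pp(1)]
          have small1: "4 * k ^ (k + 1) * D' * L ^ k * p powr (1 / k) \<le> \<epsilon> * \<gamma>"
            using small assms by (simp add: L_def field_simps)
          have "K * L * p powr (1 / (2 * k)) * p powr (1 / (2 * k)) \<le> 1 * p powr (1 / (2 * k))"
            using small by (intro mult_right_mono) (auto simp: L_def)
          also have "K * L * p powr (1 / (2 * k)) * p powr (1 / (2 * k)) = K * L * p powr (1 / k)"
            using k0 by (simp add: powr_add[symmetric] field_simps)
          finally have small2: "K * L * p powr (1 / k) \<le> p powr (1 / (2 * k))" by simp
          \<comment> \<open>A large \<open>G\<close> forces a large \<mu> and hence a large
            \<open>x\<close>; passing to exponent \<open>k\<close> keeps \<open>C\<close>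
            independent of \<open>q\<close>.\<close>
          have "D' * B ^ q \<le> D' * B ^ k"
            using D' B H(2) by (intro mult_left_mono power_increasing) auto
          also have "\<dots> < G" using large C by simp
          also have "G \<le> \<mu>" by (simp add: G_def)
          also have "\<dots> \<le> D' * x ^ q" by (rule \<mu>_le)
          finally have "B ^ q < x ^ q" using D' by simp
          then have Bx: "B < x" using x_nonneg by (rule power_less_imp_less_base)
          have "?prob \<le> exp (- (ln ((1 + \<epsilon> / 2) / (1 + \<epsilon> / 4)) * \<kappa> / 2 * G)) + exp (- (c\<^sub>1 / (8 * k * D') * G))"
            using large C B Bx
            by (intro upper_tail_small_p[OF assms(1) \<gamma>\<mu> assms(3) \<mu> D'(1) small1 small2[unfolded K_def]
                  pp(2) \<kappa> c\<^sub>1]) auto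
          also have "\<dots> \<le> exp (- (e2 * G)) + exp (- (e2 * G))"
          proof (intro add_mono exp_le_cancel_iff[THEN iffD2] le_imp_neg_le mult_right_mono)
            show "e2 \<le> ln ((1 + \<epsilon> / 2) / (1 + \<epsilon> / 4)) * \<kappa> / 2" "e2 \<le> c\<^sub>1 / (8 * k * D')"
              unfolding e2_def by (rule min.cobounded1, rule min.cobounded2)
          qed (use G0 in auto)
          also have "\<dots> = exp (ln 2 - e2 * G)" by (simp add: exp_diff exp_minus divide_inverse)
          also have "\<dots> \<le> exp (- c * G)"
          proof -
            have "2 * ln 2 / e2 \<le> G" using C large by simp
            then have "ln 2 \<le> e2 / 2 * G" using e2 by (simp add: field_simps)
            moreover have "c * G \<le> e2 / 2 * G" using c G0 by (intro mult_right_mono) auto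
            ultimately show ?thesis by simp
          qed
          finally show ?thesis .
        qed
      qed
    qed
    have "ln (exp 1 / p) = L" using H(8) by (simp add: L_def ln_div)
    then show "let Vp = binomial_subset (verts H) p;
        X = (\<lambda>W. real (num_edges (induced H W)));
        \<mu> = measure_pmf.expectation Vp X
      in measure_pmf.prob Vp {W. X W \<ge> (1 + \<epsilon>) * \<mu>}
        \<le> exp (- c * min \<mu> (\<mu> powr (1 / real q) * ln (exp 1 / p)))"
      using main by (simp add: Let_def expectation_num_edges G_def)
  qed
qed

end
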